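(* For every $(i,j,k)\in\mathbb{Z}^3$, the cluster variable $z_i^{j,k}$ is the Laurent polynomial $$z_i^{j,k}=x_r\,A^{\lfloor \frac{(i^2+ij+j^2+1)+i+2j}{3}\rfloor}\,B^{\lfloor \frac{(i^2+ij+j^2+1)+2i+j}{3}\rfloor}\,C^{\lfloor \frac{i^2+ij+j^2+1}{3}\rfloor}\,D^{\lfloor \frac{(k-1)^2}{4}\rfloor}\,E^{\lfloor \frac{k^2}{4}\rfloor},$$ where $A=\frac{x_3x_5+x_4x_6}{x_1x_2}$, $B=\frac{x_1x_6+x_2x_5}{x_3x_4}$, $C=\frac{x_1x_3+x_2x_4}{x_5x_6}$, $D=\frac{x_1x_3x_6+x_2x_3x_5+x_2x_4x_6}{x_1x_4x_5}$, $E=\frac{x_2x_4x_5+x_1x_3x_5+x_1x_4x_6}{x_2x_3x_6}$, and the index $r\in\{1,\dots,6\}$ is determined by $2(i-j)+3k \bmod 6$: $r=1$ if $2(i-j)+3k\equiv 5$, $r=2$ if $\equiv 2$, $r=3$ if $\equiv 4$, $r=4$ if $\equiv 1$, $r=5$ if $\equiv 3$, $r=6$ if $\equiv 0 \pmod 6$. In particular $x_r$ is uniquely determined by $(i-j)\bmod 3$ and $k \bmod 2$.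
   Context: Let $Q$ be the quiver with vertices $1,\dots,6$ and the twelve arrows $1\to6,\ 6\to4,\ 4\to2,\ 2\to5,\ 5\to3,\ 3\to1,\ 1\to4,\ 4\to5,\ 5\to1,\ 2\to3,\ 3\to6,\ 6\to2$ (the $dP_3$ quiver). Consider the coefficient-free cluster algebra with initial seed $(Q,(x_1,\dots,x_6))$, $x_r$ sitting at vertex $r$. Mutation $\mu_i$ at vertex $i$ changes the quiver by: adding an arrow $j\to k$ for each path $j\to i\to k$, reversing all arrows at $i$, and deleting 2-cycles; and replaces the variable $y_i$ at vertex $i$ by $y_i'$ with $y_iy_i'=\prod_{i\to j}y_j+\prod_{j\to i}y_j$ (products over arrows, with multiplicity), other variables unchanged. Seeds are tracked as ordered lists $[y_1,\dots,y_6]$ ($y_r$ at vertex $r$). Define operations on ordered seeds: $\tau_1$: mutate at vertices 1 and 2, then swap positions 1 and 2; $\tau_2$: mutate at 3 and 4, then swap positions 3,4; $\tau_3$: mutate at 5 and 6, then swap positions 5,6; $\tau_4$: mutate successively at vertices $1,4,1,5,1$, then move the entry (and vertex label) in position 1 to position 4, position 4 to position 5, position 5 to position 1; $\tau_5$: mutate successively at $2,3,2,6,2$, then move position 2 to 3, 3 to 6, 6 to 2. Each $\tau_i$ returns the quiver to $Q$. A generalized $\tau$-mutation sequence is a word $S$ in $\tau_1,\dots,\tau_5$, applied left to right starting from $[x_1,\dots,x_6]$; $Z^S=[z^S_1,\dots,z^S_6]$ denotes the resulting ordered cluster. Lattice coordinates: let $L^\Delta$ be the triangulation of $\mathbb{Z}^2$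 cutting each unit square along its diagonal of slope $-1$; its triangles (alcoves) are $\{(i,j),(i-1,j+1),(i,j+1)\}$ and $\{(i,j),(i-1,j+1),(i-1,j)\}$. Color each point $(I,J)$ by $I-J \bmod 3$ (using representatives $1,2,3$); every alcove has one vertex of each color. For $r\in\{1,2,3\}$, the flip $s_r$ replaces the vertex of color $r$ of an alcove by the unique other lattice point forming an alcove with the opposite edge. For a word $S_1$ in $\tau_1,\tau_2,\tau_3$ let $T_{S_1}$ be the alcove obtained from $\{(0,-1),(-1,0),(0,0)\}$ by applying $s_r$ for each letter $\tau_r$ of $S_1$, left to right, and write $T_{S_1}=\{(i_1,j_1),(i_2,j_2),(i_3,j_3)\}$ with $i_r-j_r\equiv r \pmod 3$. For an alternating word $S_2$ in $\tau_4,\tau_5$ set $\{k_1,k_2\}=\{|S_2|,|S_2|+1\}$ if $S_2$ starts with $\tau_5$ and $\{-|S_2|,-|S_2|+1\}$ if it starts with $\tau_4$ (either if empty), with $k_1=\pm|S_2|$ if $|S_2|$ is odd and $k_2=\pm|S_2|$ if $|S_2|$ is even. For $S=S_1S_2$ define the prism $\Delta^S=[(i_1,j_1,k_1),(i_1,j_1,k_2),(i_2,j_2,k_2),(i_2,j_2,k_1),(i_3,j_3,k_1),(i_3,j_3,k_2)]$ (so $\Delta^{\emptyset}=[(0,-1,1),(0,-1,0),(-1,0,0),(-1,0,1),(0,0,1),(0,0,0)]$). Attaching the $r$-th entry of $Z^S$ to the $r$-th point of $\Delta^S$ gives a well-defined assignment depending only on the lattice point, and every point of $\mathbb{Z}^3$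 occurs; the cluster variable attached to $(i,j,k)$ is denoted $z_i^{j,k}$. *)

theory Defs
  imports
    "HOL-Library.Numeral_Type"
    "HOL-Library.Poly_Mapping"
    "HOL-Number_Theory.Cong"
    "HOL-Computational_Algebra.Fraction_Field"
    "HOL-Combinatorics.Cycles"
begin

text \<open>Vertices of quivers and positions in clusters are elements of the six-element type
  \<open>6\<close> = {1, 2, 3, 4, 5, 6}; note that in this type the numeral 6 coincides with 0.

  The ambient field is the fraction field of \<open>\<int>[x\<^sub>1, \<dots>, x\<^sub>6]\<close>, i.e. \<open>\<rat>(x\<^sub>1, \<dots>, x\<^sub>6)\<close>.
  A polynomial is a finitely supported map from exponent vectors to coefficients.\<close>

type_synonym poly6 = "(6 \<Rightarrow>\<^sub>0 nat) \<Rightarrow>\<^sub>0 int"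
type_synonym ratfun6 = "poly6 fract"

definition monomial6 :: "(6 \<Rightarrow>\<^sub>0 nat) \<Rightarrow> poly6" where
  "monomial6 e = Poly_Mapping.single e 1"

definition x :: "6 \<Rightarrow> ratfun6" where
  "x r = Fract (monomial6 (Poly_Mapping.single r 1)) 1"

definition laurent_polynomial :: "ratfun6 \<Rightarrow> bool" where
  "laurent_polynomial f \<longleftrightarrow> (\<exists>p e. f = Fract p (monomial6 e))"


text \<open>A quiver is given by its arrow multiplicities: \<open>Q j k\<close> is the number of arrows from \<open>j\<close>
  to \<open>k\<close>. A seed carries the variable \<open>y r\<close> at vertex \<open>r\<close>.\<close>

type_synonym quiver = "6 \<Rightarrow> 6 \<Rightarrow> nat"
type_synonym seed = "quiver \<times> (6 \<Rightarrow> ratfun6)"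

definition dP3_quiver :: quiver where
  "dP3_quiver j k = (if (j, k) \<in>
     {(1, 6), (6, 4), (4, 2), (2, 5), (5, 3), (3, 1),
      (1, 4), (4, 5), (5, 1), (2, 3), (3, 6), (6, 2)} then 1 else 0)"

definition add_paths :: "6 \<Rightarrow> quiver \<Rightarrow> quiver" where
  "add_paths i Q = (\<lambda>j k. Q j k + Q j i * Q i k)"

definition reverse_at :: "6 \<Rightarrow> quiver \<Rightarrow> quiver" where
  "reverse_at i Q = (\<lambda>j k. if j = i \<or> k = i then Q k j else Q j k)"

definition cancel_2_cycles :: "quiver \<Rightarrow> quiver" where
  "cancel_2_cycles Q = (\<lambda>j k. Q j k - min (Q j k) (Q k j))"

definition mutate_quiver :: "6 \<Rightarrow> quiver \<Rightarrow> quiver" where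
  "mutate_quiver i Q = cancel_2_cycles (reverse_at i (add_paths i Q))"

definition mutate :: "6 \<Rightarrow> seed \<Rightarrow> seed" where
  "mutate i = (\<lambda>(Q, y).
     (mutate_quiver i Q,
      y(i := ((\<Prod>j\<in>UNIV. y j ^ Q i j) + (\<Prod>j\<in>UNIV. y j ^ Q j i)) / y i)))"

text \<open>Move the entry and the label of each vertex \<open>r\<close> to position \<open>p r\<close>.\<close>

definition relabel :: "(6 \<Rightarrow> 6) \<Rightarrow> seed \<Rightarrow> seed" where
  "relabel p = (\<lambda>(Q, y). (\<lambda>j k. Q (inv p j) (inv p k), \<lambda>r. y (inv p r)))"

datatype letter = Tau1 | Tau2 | Tau3 | Tau4 | Tau5

text \<open>\<open>cycle_of_list [a, b, c]\<close> sends \<open>a\<close> to \<open>b\<close>, \<open>b\<close> to \<open>c\<close> and \<open>c\<close> to \<open>a\<close>;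
  \<open>fold\<close> performs the mutations from left to right.\<close>

fun \<tau> :: "letter \<Rightarrow> seed \<Rightarrow> seed" where
  "\<tau> Tau1 s = relabel (cycle_of_list [1, 2]) (fold mutate [1, 2] s)"
| "\<tau> Tau2 s = relabel (cycle_of_list [3, 4]) (fold mutate [3, 4] s)"
| "\<tau> Tau3 s = relabel (cycle_of_list [5, 6]) (fold mutate [5, 6] s)"
| "\<tau> Tau4 s = relabel (cycle_of_list [1, 4, 5]) (fold mutate [1, 4, 1, 5, 1] s)"
| "\<tau> Tau5 s = relabel (cycle_of_list [2, 3, 6]) (fold mutate [2, 3, 2, 6, 2] s)"

definition initial_seed :: seed where
  "initial_seed = (dP3_quiver, x)"

definition cluster :: "letter list \<Rightarrow> ratfun6 list" where
  "cluster S = map (snd (fold \<tau> S initial_seed)) [1, 2, 3, 4, 5, 6]"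


definition alcove :: "(int \<times> int) set \<Rightarrow> bool" where
  "alcove T \<longleftrightarrow> (\<exists>i j. T = {(i, j), (i - 1, j + 1), (i, j + 1)}
                     \<or> T = {(i, j), (i - 1, j + 1), (i - 1, j)})"

definition has_color :: "int \<Rightarrow> int \<times> int \<Rightarrow> bool" where
  "has_color r p \<longleftrightarrow> [fst p - snd p = r] (mod 3)"

definition flip :: "int \<Rightarrow> (int \<times> int) set \<Rightarrow> (int \<times> int) set" where
  "flip r T = (let e = {p \<in> T. \<not> has_color r p}
               in insert (THE q. q \<notin> T \<and> alcove (insert q e)) e)"

definition color_vertex :: "int \<Rightarrow> (int \<times> int) set \<Rightarrow> int \<times> int" where
  "color_vertex r T = (THE p. p \<in> T \<and> has_color r p)"

text \<open>Only \<open>\<tau>\<^sub>1, \<tau>\<^sub>2, \<tau>\<^sub>3\<close> act on alcoves; the last two equations are dummies.\<close>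

fun letter_flip :: "letter \<Rightarrow> (int \<times> int) set \<Rightarrow> (int \<times> int) set" where
  "letter_flip Tau1 T = flip 1 T"
| "letter_flip Tau2 T = flip 2 T"
| "letter_flip Tau3 T = flip 3 T"
| "letter_flip Tau4 T = T"
| "letter_flip Tau5 T = T"

definition word_alcove :: "letter list \<Rightarrow> (int \<times> int) set" where
  "word_alcove S1 = fold letter_flip S1 {(0, -1), (-1, 0), (0, 0)}"

text \<open>The pair \<open>(k\<^sub>1, k\<^sub>2)\<close> of heights: \<open>n = \<plusminus>|S\<^sub>2|\<close> and \<open>n + 1\<close>, where \<open>n\<close> is \<open>k\<^sub>1\<close> if
  \<open>|S\<^sub>2|\<close> is odd and \<open>k\<^sub>2\<close> if it is even.\<close>

definition heights :: "letter list \<Rightarrow> int \<times> int" where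
  "heights S2 =
    (let n = (if S2 \<noteq> [] \<and> hd S2 = Tau4 then - int (length S2) else int (length S2))
     in if odd (length S2) then (n, n + 1) else (n + 1, n))"

definition prism :: "letter list \<Rightarrow> letter list \<Rightarrow> (int \<times> int \<times> int) list" where
  "prism S1 S2 =
    (let (i1, j1) = color_vertex 1 (word_alcove S1);
         (i2, j2) = color_vertex 2 (word_alcove S1);
         (i3, j3) = color_vertex 3 (word_alcove S1);
         (k1, k2) = heights S2
     in [(i1, j1, k1), (i1, j1, k2), (i2, j2, k2), (i2, j2, k1), (i3, j3, k1), (i3, j3, k2)])"

definition attached :: "int \<times> int \<times> int \<Rightarrow> ratfun6 \<Rightarrow> bool" where
  "attached p v \<longleftrightarrow> (\<exists>S1 S2. set S1 \<subseteq> {Tau1, Tau2, Tau3} \<and> set S2 \<subseteq> {Tau4, Tau5}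
      \<and> distinct_adj S2 \<and> (p, v) \<in> set (zip (prism S1 S2) (cluster (S1 @ S2))))"

definition z :: "int \<Rightarrow> int \<Rightarrow> int \<Rightarrow> ratfun6" where
  "z i j k = (THE v. attached (i, j, k) v)"


definition A :: ratfun6 where
  "A = (x 3 * x 5 + x 4 * x 6) / (x 1 * x 2)"

definition B :: ratfun6 where
  "B = (x 1 * x 6 + x 2 * x 5) / (x 3 * x 4)"

definition C :: ratfun6 where
  "C = (x 1 * x 3 + x 2 * x 4) / (x 5 * x 6)"

definition D :: ratfun6 where
  "D = (x 1 * x 3 * x 6 + x 2 * x 3 * x 5 + x 2 * x 4 * x 6) / (x 1 * x 4 * x 5)"

definition E :: ratfun6 where
  "E = (x 2 * x 4 * x 5 + x 1 * x 3 * x 5 + x 1 * x 4 * x 6) / (x 2 * x 3 * x 6)"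

text \<open>The last case is residue 0.\<close>

definition var_index :: "int \<Rightarrow> int \<Rightarrow> int \<Rightarrow> 6" where
  "var_index i j k =
    (let m = (2 * (i - j) + 3 * k) mod 6
     in if m = 5 then 1 else if m = 2 then 2 else if m = 4 then 3
        else if m = 1 then 4 else if m = 3 then 5 else 6)"

end

(* The claimed monomials satisfy the exchange relations. Write the formula as
   x_r * face_factor (i, j) * height_factor k. A flip of an alcove at a vertex p moves p to
   p' = q + r - p across the opposite edge q r; the quadratic form i^2 + i j + j^2 satisfies
   N(p') + N(p) = N(q) + N(r) + 1, so after division by 3 the exponents of A, B, C obey the
   same relation with the extra 1 going to exactly one of them, according to the color of p.
   Together with x_1 x_2 A = x_3 x_5 + x_4 x_6 (and its analogues) this is the exchange relation
   of tau_1, tau_2, tau_3. The five mutations of tau_4 multiply y_1, y_4, y_5 by D evaluated at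
   the current seed, which is D (g(k_2) / g(k_1))^2 for g the height factor; this matches the
   second difference of floor(k^2/4), which is 0 or 1 by parity. The same holds for tau_5. *)
theory Submission
  imports Defs
begin

section \<open>Mutations of the quiver\<close>

lemma forall_6: "(\<forall>r::6. P r) \<longleftrightarrow> P 1 \<and> P 2 \<and> P 3 \<and> P 4 \<and> P 5 \<and> P 6"
proof (intro iffI allI)
  fix r :: 6
  assume P: "P 1 \<and> P 2 \<and> P 3 \<and> P 4 \<and> P 5 \<and> P 6"
  show "P r"
  proof (cases r)
    case (of_int z)
    then have z: "z \<in> {0, 1, 2, 3, 4, 5}" by auto
    \<comment> \<open>The representatives of the type run from 0 to 5 while the vertices are named 1
      to 6, so the case 0 is vertex 6.\<close>
    have "(0::6) = 6" by simp
    with P have "P 0" by simp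
    then show ?thesis using P of_int(1) z by auto
  qed
qed simp

lemma UNIV_6: "(UNIV :: 6 set) = {1, 2, 3, 4, 5, 6}"
  by (simp add: set_eq_iff forall_6)

lemma prod_6: "(\<Prod>r::6\<in>UNIV. f r) = f 1 * f 2 * f 3 * f 4 * f 5 * f 6"
  for f :: "6 \<Rightarrow> 'a::comm_monoid_mult"
  unfolding UNIV_6 by (simp add: mult.assoc)

text \<open>Used once, this is a cluster; nested twice, it is an adjacency matrix whose rows list
  the outgoing arrows. Equalities of such functions reduce to six entries each.\<close>

definition vec6 :: "'a \<Rightarrow> 'a \<Rightarrow> 'a \<Rightarrow> 'a \<Rightarrow> 'a \<Rightarrow> 'a \<Rightarrow> 6 \<Rightarrow> 'a" where
  "vec6 a b c d e f = (\<lambda>_. f)(1 := a, 2 := b, 3 := c, 4 := d, 5 := e)"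

lemma vec6_simps [simp]:
  "vec6 a b c d e f 1 = a" "vec6 a b c d e f 2 = b" "vec6 a b c d e f 3 = c"
  "vec6 a b c d e f 4 = d" "vec6 a b c d e f 5 = e" "vec6 a b c d e f 6 = f"
  by (simp_all add: vec6_def)

lemma fun_eq_vec6: "g = vec6 a b c d e f \<longleftrightarrow> g 1 = a \<and> g 2 = b \<and> g 3 = c \<and> g 4 = d \<and> g 5 = e \<and> g 6 = f"
  by (simp add: fun_eq_iff forall_6)

lemma neq_6 [simp]:
  "(1::6) \<noteq> 2" "(1::6) \<noteq> 3" "(1::6) \<noteq> 4" "(1::6) \<noteq> 5" "(1::6) \<noteq> 6"
  "(2::6) \<noteq> 1" "(2::6) \<noteq> 3" "(2::6) \<noteq> 4" "(2::6) \<noteq> 5" "(2::6) \<noteq> 6"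
  "(3::6) \<noteq> 1" "(3::6) \<noteq> 2" "(3::6) \<noteq> 4" "(3::6) \<noteq> 5" "(3::6) \<noteq> 6"
  "(4::6) \<noteq> 1" "(4::6) \<noteq> 2" "(4::6) \<noteq> 3" "(4::6) \<noteq> 5" "(4::6) \<noteq> 6"
  "(5::6) \<noteq> 1" "(5::6) \<noteq> 2" "(5::6) \<noteq> 3" "(5::6) \<noteq> 4" "(5::6) \<noteq> 6"
  "(6::6) \<noteq> 1" "(6::6) \<noteq> 2" "(6::6) \<noteq> 3" "(6::6) \<noteq> 4" "(6::6) \<noteq> 5"
  by simp_all

lemma dP3_quiver_eq:
  "dP3_quiver = vec6 (vec6 0 0 0 1 0 1) (vec6 0 0 1 0 1 0) (vec6 1 0 0 0 0 1)
     (vec6 0 1 0 0 1 0) (vec6 1 0 1 0 0 0) (vec6 0 1 0 1 0 0)"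
  by (simp add: fun_eq_vec6 dP3_quiver_def)

lemmas mutate_simps = mutate_def mutate_quiver_def add_paths_def reverse_at_def cancel_2_cycles_def prod_6

text \<open>The digits are the vertices of the mutation sequence applied to \<open>dP3_quiver\<close>.\<close>

definition dP3_mut1 :: quiver where
  "dP3_mut1 =
     vec6 (vec6 0 0 1 0 1 0)
       (vec6 0 0 1 0 1 0)
       (vec6 0 0 0 1 0 2)
       (vec6 1 1 0 0 0 0)
       (vec6 0 0 1 0 0 1)
       (vec6 1 1 0 1 0 0)"

text \<open>The cluster stays arbitrary, so each quiver of a mutation sequence is computed once and
  the result serves at every position of every word.\<close>

lemma mutate_dP3_mut1:
  "mutate 1 (dP3_quiver, y) =
     (dP3_mut1, y(1 := (y 4 * y 6 + y 3 * y 5) / y 1))"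
  by (simp add: mutate_simps fun_eq_vec6 dP3_quiver_eq dP3_mut1_def)

definition dP3_mut12 :: quiver where
  "dP3_mut12 =
     vec6 (vec6 0 0 1 0 1 0)
       (vec6 0 0 0 1 0 1)
       (vec6 0 1 0 0 0 1)
       (vec6 1 0 0 0 1 0)
       (vec6 0 1 1 0 0 0)
       (vec6 1 0 0 1 0 0)"

lemma mutate_dP3_mut12:
  "mutate 2 (dP3_mut1, y) =
     (dP3_mut12, y(2 := (y 3 * y 5 + y 4 * y 6) / y 2))"
  by (simp add: mutate_simps fun_eq_vec6 dP3_mut1_def dP3_mut12_def)

definition dP3_mut3 :: quiver where
  "dP3_mut3 =
     vec6 (vec6 0 0 1 1 0 1)
       (vec6 1 0 0 0 1 0)
       (vec6 0 1 0 0 1 0)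
       (vec6 0 1 0 0 1 0)
       (vec6 2 0 0 0 0 1)
       (vec6 0 0 1 1 0 0)"

lemma mutate_dP3_mut3:
  "mutate 3 (dP3_quiver, y) =
     (dP3_mut3, y(3 := (y 1 * y 6 + y 2 * y 5) / y 3))"
  by (simp add: mutate_simps fun_eq_vec6 dP3_quiver_eq dP3_mut3_def)

definition dP3_mut34 :: quiver where
  "dP3_mut34 =
     vec6 (vec6 0 0 1 0 0 1)
       (vec6 0 0 0 1 1 0)
       (vec6 0 1 0 0 1 0)
       (vec6 1 0 0 0 0 1)
       (vec6 1 0 0 1 0 0)
       (vec6 0 1 1 0 0 0)"

lemma mutate_dP3_mut34:
  "mutate 4 (dP3_mut3, y) =
     (dP3_mut34, y(4 := (y 2 * y 5 + y 1 * y 6) / y 4))"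
  by (simp add: mutate_simps fun_eq_vec6 dP3_mut3_def dP3_mut34_def)

definition dP3_mut5 :: quiver where
  "dP3_mut5 =
     vec6 (vec6 0 0 0 0 1 1)
       (vec6 1 0 2 0 0 0)
       (vec6 1 0 0 0 1 1)
       (vec6 0 1 1 0 0 0)
       (vec6 0 1 0 1 0 0)
       (vec6 0 1 0 1 0 0)"

lemma mutate_dP3_mut5:
  "mutate 5 (dP3_quiver, y) =
     (dP3_mut5, y(5 := (y 1 * y 3 + y 2 * y 4) / y 5))"
  by (simp add: mutate_simps fun_eq_vec6 dP3_quiver_eq dP3_mut5_def)

definition dP3_mut56 :: quiver where
  "dP3_mut56 =
     vec6 (vec6 0 0 0 1 1 0)
       (vec6 0 0 1 0 0 1)
       (vec6 1 0 0 0 1 0)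
       (vec6 0 1 0 0 0 1)
       (vec6 0 1 0 1 0 0)
       (vec6 1 0 1 0 0 0)"

lemma mutate_dP3_mut56:
  "mutate 6 (dP3_mut5, y) =
     (dP3_mut56, y(6 := (y 2 * y 4 + y 1 * y 3) / y 6))"
  by (simp add: mutate_simps fun_eq_vec6 dP3_mut5_def dP3_mut56_def)

definition dP3_mut14 :: quiver where
  "dP3_mut14 =
     vec6 (vec6 0 0 0 1 1 0)
       (vec6 0 0 0 1 1 0)
       (vec6 0 0 0 0 0 2)
       (vec6 0 0 1 0 0 1)
       (vec6 0 0 1 0 0 1)
       (vec6 2 2 0 0 0 0)"

lemma mutate_dP3_mut14:
  "mutate 4 (dP3_mut1, y) =
     (dP3_mut14, y(4 := (y 1 * y 2 + y 3 * y 6) / y 4))"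
  by (simp add: mutate_simps fun_eq_vec6 dP3_mut1_def dP3_mut14_def)

definition dP3_mut141 :: quiver where
  "dP3_mut141 =
     vec6 (vec6 0 0 0 0 0 2)
       (vec6 0 0 0 1 1 0)
       (vec6 0 0 0 0 0 2)
       (vec6 1 0 1 0 0 0)
       (vec6 1 0 1 0 0 0)
       (vec6 0 2 0 1 1 0)"

text \<open>The double arrow from 6 to 1 in \<open>dP3_mut14\<close> produces the square.\<close>

lemma mutate_dP3_mut141:
  "mutate 1 (dP3_mut14, y) =
     (dP3_mut141, y(1 := (y 4 * y 5 + (y 6)\<^sup>2) / y 1))"
  by (simp add: mutate_simps fun_eq_vec6 dP3_mut14_def dP3_mut141_def)

definition dP3_mut1415 :: quiver where
  "dP3_mut1415 =
     vec6 (vec6 0 0 0 0 1 1)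
       (vec6 1 0 1 1 0 0)
       (vec6 0 0 0 0 1 1)
       (vec6 1 0 1 0 0 0)
       (vec6 0 1 0 0 0 1)
       (vec6 0 2 0 1 0 0)"

lemma mutate_dP3_mut1415:
  "mutate 5 (dP3_mut141, y) =
     (dP3_mut1415, y(5 := (y 1 * y 3 + y 2 * y 6) / y 5))"
  by (simp add: mutate_simps fun_eq_vec6 dP3_mut141_def dP3_mut1415_def)

definition dP3_mut14151 :: quiver where
  "dP3_mut14151 =
     vec6 (vec6 0 1 0 1 0 0)
       (vec6 0 0 1 1 0 0)
       (vec6 0 0 0 0 1 1)
       (vec6 0 0 1 0 1 0)
       (vec6 1 0 0 0 0 1)
       (vec6 1 1 0 0 0 0)"

lemma mutate_dP3_mut14151:
  "mutate 1 (dP3_mut1415, y) =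
     (dP3_mut14151, y(1 := (y 5 * y 6 + y 2 * y 4) / y 1))"
  by (simp add: mutate_simps fun_eq_vec6 dP3_mut1415_def dP3_mut14151_def)

definition dP3_mut2 :: quiver where
  "dP3_mut2 =
     vec6 (vec6 0 0 0 1 0 1)
       (vec6 0 0 0 1 0 1)
       (vec6 1 1 0 0 0 0)
       (vec6 0 0 1 0 2 0)
       (vec6 1 1 1 0 0 0)
       (vec6 0 0 0 1 1 0)"

lemma mutate_dP3_mut2:
  "mutate 2 (dP3_quiver, y) =
     (dP3_mut2, y(2 := (y 3 * y 5 + y 4 * y 6) / y 2))"
  by (simp add: mutate_simps fun_eq_vec6 dP3_quiver_eq dP3_mut2_def)

definition dP3_mut23 :: quiver where
  "dP3_mut23 =
     vec6 (vec6 0 0 1 0 0 1)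
       (vec6 0 0 1 0 0 1)
       (vec6 0 0 0 1 1 0)
       (vec6 0 0 0 0 2 0)
       (vec6 2 2 0 0 0 0)
       (vec6 0 0 0 1 1 0)"

lemma mutate_dP3_mut23:
  "mutate 3 (dP3_mut2, y) =
     (dP3_mut23, y(3 := (y 1 * y 2 + y 4 * y 5) / y 3))"
  by (simp add: mutate_simps fun_eq_vec6 dP3_mut2_def dP3_mut23_def)

definition dP3_mut232 :: quiver where
  "dP3_mut232 =
     vec6 (vec6 0 0 1 0 0 1)
       (vec6 0 0 0 0 2 0)
       (vec6 0 1 0 1 0 0)
       (vec6 0 0 0 0 2 0)
       (vec6 2 0 1 0 0 1)
       (vec6 0 1 0 1 0 0)"

lemma mutate_dP3_mut232:
  "mutate 2 (dP3_mut23, y) =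
     (dP3_mut232, y(2 := (y 3 * y 6 + (y 5)\<^sup>2) / y 2))"
  by (simp add: mutate_simps fun_eq_vec6 dP3_mut23_def dP3_mut232_def)

definition dP3_mut2326 :: quiver where
  "dP3_mut2326 =
     vec6 (vec6 0 1 1 1 0 0)
       (vec6 0 0 0 0 1 1)
       (vec6 0 1 0 1 0 0)
       (vec6 0 0 0 0 1 1)
       (vec6 2 0 1 0 0 0)
       (vec6 1 0 0 0 1 0)"

lemma mutate_dP3_mut2326:
  "mutate 6 (dP3_mut232, y) =
     (dP3_mut2326, y(6 := (y 2 * y 4 + y 1 * y 5) / y 6))"
  by (simp add: mutate_simps fun_eq_vec6 dP3_mut232_def dP3_mut2326_def)

definition dP3_mut23262 :: quiver where
  "dP3_mut23262 =
     vec6 (vec6 0 0 1 1 0 0)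
       (vec6 1 0 1 0 0 0)
       (vec6 0 0 0 1 0 1)
       (vec6 0 0 0 0 1 1)
       (vec6 1 1 0 0 0 0)
       (vec6 0 1 0 0 1 0)"

lemma mutate_dP3_mut23262:
  "mutate 2 (dP3_mut2326, y) =
     (dP3_mut23262, y(2 := (y 5 * y 6 + y 1 * y 3) / y 2))"
  by (simp add: mutate_simps fun_eq_vec6 dP3_mut2326_def dP3_mut23262_def)

section \<open>Relabelling back to the dP3 quiver, and the effect of the five operations on a
  cluster\<close>

lemma inv_cycle_2: "a \<noteq> b \<Longrightarrow> inv (cycle_of_list [a, b]) = cycle_of_list [a, b]"
  by (rule inv_unique_comp) (auto simp: fun_eq_iff transpose_def)

lemma inv_cycle_3:
  "distinct [a, b, c] \<Longrightarrow> inv (cycle_of_list [a, b, c]) = cycle_of_list [c, b, a]"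
  by (rule inv_unique_comp) (auto simp: fun_eq_iff transpose_def)

text \<open>Each mutation sequence ends in a relabelled copy of the dP3 quiver. A position receives
  the entry of its preimage under the cycle, so for the cycle 1, 4, 5 the entry of 5 lands at
  1.\<close>

lemma relabel_dP3:
  "relabel (cycle_of_list [1, 2]) (dP3_mut12, y) = (dP3_quiver, y(1 := y 2, 2 := y 1))"
  "relabel (cycle_of_list [3, 4]) (dP3_mut34, y) = (dP3_quiver, y(3 := y 4, 4 := y 3))"
  "relabel (cycle_of_list [5, 6]) (dP3_mut56, y) = (dP3_quiver, y(5 := y 6, 6 := y 5))"
  "relabel (cycle_of_list [1, 4, 5]) (dP3_mut14151, y) =
     (dP3_quiver, y(1 := y 5, 4 := y 1, 5 := y 4))"
  "relabel (cycle_of_list [2, 3, 6]) (dP3_mut23262, y) =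
     (dP3_quiver, y(2 := y 6, 3 := y 2, 6 := y 3))"
  by (simp_all add: relabel_def dP3_quiver_eq inv_cycle_2 inv_cycle_3 fun_eq_vec6 fun_eq_iff forall_6 transpose_def
      dP3_mut12_def dP3_mut34_def dP3_mut56_def dP3_mut14151_def dP3_mut23262_def
      del: cycle_of_list.simps) (simp_all add: transpose_def)

text \<open>No arrow joins 1 and 2, and the out-neighbours of one are the in-neighbours of the
  other, so both mutations use the same binomial. The swap then crosses the denominators.\<close>

lemma tau1_seed:
  "\<tau> Tau1 (dP3_quiver, y) =
     (dP3_quiver, y(1 := (y 3 * y 5 + y 4 * y 6) / y 2, 2 := (y 3 * y 5 + y 4 * y 6) / y 1))"
  by (simp add: mutate_dP3_mut1 mutate_dP3_mut12 relabel_dP3 del: cycle_of_list.simps)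
    (simp add: fun_eq_iff forall_6 add.commute)

lemma tau2_seed:
  "\<tau> Tau2 (dP3_quiver, y) =
     (dP3_quiver, y(3 := (y 1 * y 6 + y 2 * y 5) / y 4, 4 := (y 1 * y 6 + y 2 * y 5) / y 3))"
  by (simp add: mutate_dP3_mut3 mutate_dP3_mut34 relabel_dP3 del: cycle_of_list.simps)
    (simp add: fun_eq_iff forall_6 add.commute)

lemma tau3_seed:
  "\<tau> Tau3 (dP3_quiver, y) =
     (dP3_quiver, y(5 := (y 1 * y 3 + y 2 * y 4) / y 6, 6 := (y 1 * y 3 + y 2 * y 4) / y 5))"
  by (simp add: mutate_dP3_mut5 mutate_dP3_mut56 relabel_dP3 del: cycle_of_list.simps)
    (simp add: fun_eq_iff forall_6 add.commute)

text \<open>The last value is free of nested fractions because \<open>a''\<close> collapses to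
  \<open>(a f + b e) / d\<close>: the product \<open>(d f + c e) (a f + b e)\<close> appears in its numerator.\<close>

lemma tau4_step:
  fixes a :: "'a::field"
  assumes "a \<noteq> 0" "d \<noteq> 0" "e \<noteq> 0" "c * e + d * f \<noteq> 0" "a * f + b * e \<noteq> 0"
  defines "\<delta> \<equiv> (a * c * f + b * c * e + b * d * f) / (a * d * e)"
  defines "a' \<equiv> (d * f + c * e) / a"
  defines "d' \<equiv> (a' * b + c * f) / d"
  defines "a'' \<equiv> (d' * e + f\<^sup>2) / a'"
  defines "e' \<equiv> (a'' * c + b * f) / e"
  shows "d' = e * \<delta>" "e' = a * \<delta>" "(e' * f + b * d') / a'' = d * \<delta>"
proof -
  show d': "d' = e * \<delta>"
    using assms by (simp add: divide_simps) (simp add: algebra_simps)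
  have "d' * e + f\<^sup>2 = a' * ((a * f + b * e) / d)"
    using assms(1-5) unfolding d' unfolding \<delta>_def a'_def
    by (simp add: divide_simps) (simp add: algebra_simps power2_eq_square)
  moreover have "a' \<noteq> 0"
    using assms(1,4) by (simp add: a'_def add.commute)
  ultimately have a'': "a'' = (a * f + b * e) / d"
    unfolding a''_def by simp
  show e': "e' = a * \<delta>"
    using assms(1-5) unfolding e'_def a'' \<delta>_def
    by (simp add: divide_simps) (simp add: algebra_simps)
  have "e' * f + b * d' = \<delta> * (a * f + b * e)"
    unfolding d' e' by (simp add: algebra_simps)
  then show "(e' * f + b * d') / a'' = d * \<delta>"
    using assms(2,5) unfolding a'' by simp
qed

text \<open>The two binomials assumed nonzero are, up to a factor, the values at vertex 1 after the
  first and the third mutation, and later mutations divide by these values.\<close>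

lemma tau4_seed:
  fixes y :: "6 \<Rightarrow> ratfun6"
  assumes nz: "y 1 \<noteq> 0" "y 4 \<noteq> 0" "y 5 \<noteq> 0"
    "y 3 * y 5 + y 4 * y 6 \<noteq> 0" "y 1 * y 6 + y 2 * y 5 \<noteq> 0"
  defines "\<delta> \<equiv> (y 1 * y 3 * y 6 + y 2 * y 3 * y 5 + y 2 * y 4 * y 6) / (y 1 * y 4 * y 5)"
  shows "\<tau> Tau4 (dP3_quiver, y) =
     (dP3_quiver, y(1 := y 1 * \<delta>, 4 := y 4 * \<delta>, 5 := y 5 * \<delta>))"
proof -
  define a' where "a' = (y 4 * y 6 + y 3 * y 5) / y 1"
  define d' where "d' = (a' * y 2 + y 3 * y 6) / y 4"
  define a'' where "a'' = (d' * y 5 + (y 6)\<^sup>2) / a'"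
  define e' where "e' = (a'' * y 3 + y 2 * y 6) / y 5"
  define a''' where "a''' = (e' * y 6 + y 2 * d') / a''"
  have steps:
    "mutate 1 (dP3_quiver, y) = (dP3_mut1, y(1 := a'))"
    "mutate 4 (dP3_mut1, y(1 := a')) = (dP3_mut14, y(1 := a', 4 := d'))"
    "mutate 1 (dP3_mut14, y(1 := a', 4 := d')) = (dP3_mut141, y(4 := d', 1 := a''))"
    "mutate 5 (dP3_mut141, y(4 := d', 1 := a'')) = (dP3_mut1415, y(4 := d', 1 := a'', 5 := e'))"
    "mutate 1 (dP3_mut1415, y(4 := d', 1 := a'', 5 := e')) =
       (dP3_mut14151, y(4 := d', 5 := e', 1 := a'''))"
    by (simp_all add: mutate_dP3_mut1 mutate_dP3_mut14 mutate_dP3_mut141 mutate_dP3_mut1415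
        mutate_dP3_mut14151 a'_def [symmetric] d'_def [symmetric] a''_def [symmetric]
        e'_def [symmetric] a'''_def [symmetric] fun_eq_iff forall_6)
  \<comment> \<open>The scaled entries come out displaced along a 3-cycle; the relabelling puts each
    one back at its own vertex.\<close>
  have "d' = y 5 * \<delta>" "e' = y 1 * \<delta>" "a''' = y 4 * \<delta>"
    using tau4_step [OF nz] unfolding a'_def d'_def a''_def e'_def a'''_def \<delta>_def by blast+
  moreover have "\<tau> Tau4 (dP3_quiver, y) = relabel (cycle_of_list [1, 4, 5]) (dP3_mut14151, y(4 := d', 5 := e', 1 := a'''))"
    by (simp add: steps del: cycle_of_list.simps)
  ultimately show ?thesis
    by (simp add: relabel_dP3 fun_eq_iff forall_6 del: cycle_of_list.simps \<tau>.simps)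
qed

text \<open>This is the computation of \<open>tau4_seed\<close> with the vertices 2, 3, 6, 4, 5, 1
  in the places of 1, 4, 5, 3, 6, 2. The summands are ordered so that \<open>tau4_step\<close>
  applies verbatim.\<close>

lemma tau5_seed:
  fixes y :: "6 \<Rightarrow> ratfun6"
  assumes nz: "y 2 \<noteq> 0" "y 3 \<noteq> 0" "y 6 \<noteq> 0"
    "y 4 * y 6 + y 3 * y 5 \<noteq> 0" "y 2 * y 5 + y 1 * y 6 \<noteq> 0"
  defines "\<epsilon> \<equiv> (y 2 * y 4 * y 5 + y 1 * y 4 * y 6 + y 1 * y 3 * y 5) / (y 2 * y 3 * y 6)"
  shows "\<tau> Tau5 (dP3_quiver, y) =
     (dP3_quiver, y(2 := y 2 * \<epsilon>, 3 := y 3 * \<epsilon>, 6 := y 6 * \<epsilon>))"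
proof -
  define b' where "b' = (y 3 * y 5 + y 4 * y 6) / y 2"
  define c' where "c' = (b' * y 1 + y 4 * y 5) / y 3"
  define b'' where "b'' = (c' * y 6 + (y 5)\<^sup>2) / b'"
  define f' where "f' = (b'' * y 4 + y 1 * y 5) / y 6"
  define b''' where "b''' = (f' * y 5 + y 1 * c') / b''"
  have steps:
    "mutate 2 (dP3_quiver, y) = (dP3_mut2, y(2 := b'))"
    "mutate 3 (dP3_mut2, y(2 := b')) = (dP3_mut23, y(2 := b', 3 := c'))"
    "mutate 2 (dP3_mut23, y(2 := b', 3 := c')) = (dP3_mut232, y(3 := c', 2 := b''))"
    "mutate 6 (dP3_mut232, y(3 := c', 2 := b'')) = (dP3_mut2326, y(3 := c', 2 := b'', 6 := f'))"
    "mutate 2 (dP3_mut2326, y(3 := c', 2 := b'', 6 := f')) =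
       (dP3_mut23262, y(3 := c', 6 := f', 2 := b'''))"
    by (simp_all add: mutate_dP3_mut2 mutate_dP3_mut23 mutate_dP3_mut232 mutate_dP3_mut2326
        mutate_dP3_mut23262 b'_def [symmetric] c'_def [symmetric] b''_def [symmetric]
        f'_def [symmetric] b'''_def [symmetric] fun_eq_iff forall_6
        mult.commute [of "y 1" b'] mult.commute [of "y 5" f'])
  have "c' = y 6 * \<epsilon>" "f' = y 2 * \<epsilon>" "b''' = y 3 * \<epsilon>"
    using tau4_step [OF nz] unfolding b'_def c'_def b''_def f'_def b'''_def \<epsilon>_def by blast+
  moreover have "\<tau> Tau5 (dP3_quiver, y) = relabel (cycle_of_list [2, 3, 6]) (dP3_mut23262, y(3 := c', 6 := f', 2 := b'''))"
    by (simp add: steps del: cycle_of_list.simps)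
  ultimately show ?thesis
    by (simp add: relabel_dP3 fun_eq_iff forall_6 del: cycle_of_list.simps \<tau>.simps)
qed

section \<open>Alcoves and flips\<close>

text \<open>The three unit steps that raise the color by 1. The vertices of an alcove, listed by
  increasing color, form a closed path of such steps; this treats all shapes of alcoves alike.\<close>

definition step :: "int \<times> int \<Rightarrow> int \<times> int \<Rightarrow> bool" where
  "step p q \<longleftrightarrow> (fst q - fst p, snd q - snd p) \<in> {(1, 0), (-1, 1), (0, -1)}"

definition tri :: "int \<times> int \<Rightarrow> int \<times> int \<Rightarrow> int \<times> int \<Rightarrow> bool" where
  "tri p q r \<longleftrightarrow> step p q \<and> step q r \<and> step r p"

text \<open>The fourth corner of the parallelogram with diagonal \<open>q\<close> \<open>r\<close>,
  that is, the far vertex of the other alcove on this edge.\<close>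

definition opp :: "int \<times> int \<Rightarrow> int \<times> int \<Rightarrow> int \<times> int \<Rightarrow> int \<times> int" where
  "opp p q r = (fst q + fst r - fst p, snd q + snd r - snd p)"

lemma tri_rotate: "tri p q r \<Longrightarrow> tri q r p"
  by (simp add: tri_def)

lemma tri_opp: "tri p q r \<Longrightarrow> tri (opp p q r) q r"
  by (auto simp: tri_def step_def opp_def)

text \<open>A step changes the difference of the coordinates by 1 or -2, which agree modulo
  3.\<close>

lemma has_color_step: "step p q \<Longrightarrow> has_color c p \<longleftrightarrow> has_color (c + 1) q"
  by (auto simp: step_def has_color_def cong_iff_dvd_diff) presburger+

lemma has_color_unique: "has_color c p \<Longrightarrow> has_color d p \<longleftrightarrow> [c = d] (mod 3)"
  by (auto simp: has_color_def cong_def)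

lemma tri_colors:
  assumes "tri p q r" "has_color c p"
  shows "has_color (c + 1) q" "has_color (c + 2) r"
    "\<not> has_color c q" "\<not> has_color c r" "\<not> has_color (c + 1) p" "\<not> has_color (c + 2) p"
proof -
  show q: "has_color (c + 1) q"
    using assms has_color_step tri_def by blast
  show r: "has_color (c + 2) r"
    using assms(1) q has_color_step [of q r "c + 1"] by (simp add: tri_def add.assoc)
  show "\<not> has_color c q" "\<not> has_color c r" "\<not> has_color (c + 1) p" "\<not> has_color (c + 2) p"
    using has_color_unique [OF q, of c] has_color_unique [OF r, of c]
      has_color_unique [OF assms(2), of "c + 1"] has_color_unique [OF assms(2), of "c + 2"]
    by (simp_all add: cong_iff_dvd_diff)
qed

lemma step_from: "step (i, j) q \<longleftrightarrow> q = (i + 1, j) \<or> q = (i - 1, j + 1) \<or> q = (i, j - 1)"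
  by (cases q) (simp add: step_def, presburger)

lemma step_to: "step p (i, j) \<longleftrightarrow> p = (i - 1, j) \<or> p = (i + 1, j - 1) \<or> p = (i, j + 1)"
  by (cases p) (simp add: step_def, presburger)

text \<open>Around a lattice point, three neighbours step to it and three are stepped to. Of the
  nine pairs, the closing step keeps six: the six alcoves at that point.\<close>

lemma tri_cases:
  assumes "tri p (i, j) r"
  shows "(p, r) \<in> {((i - 1, j), (i - 1, j + 1)), ((i - 1, j), (i, j - 1)),
      ((i + 1, j - 1), (i + 1, j)), ((i + 1, j - 1), (i, j - 1)),
      ((i, j + 1), (i + 1, j)), ((i, j + 1), (i - 1, j + 1))}"
proof -
  have "p = (i - 1, j) \<or> p = (i + 1, j - 1) \<or> p = (i, j + 1)"
    and "r = (i + 1, j) \<or> r = (i - 1, j + 1) \<or> r = (i, j - 1)"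
    and "step r p"
    using assms unfolding tri_def step_from step_to by blast+
  then show ?thesis
    by (elim disjE) (simp_all add: step_def)
qed

text \<open>An alcove has exactly one cyclic order in which all sides are steps, and the direction
  of one side fixes it. This links the unordered sets of the definition to oriented
  triangles.\<close>

lemma alcove_edge_iff:
  assumes "step q r"
  shows "alcove {p, q, r} \<longleftrightarrow> tri p q r"
proof
  assume "alcove {p, q, r}"
  then obtain i j where T: "{p, q, r} = {(i, j), (i - 1, j + 1), (i, j + 1)}
      \<or> {p, q, r} = {(i, j), (i - 1, j + 1), (i - 1, j)}"
    unfolding alcove_def by blast
  show "tri p q r"
    using T
  proof
    assume eq: "{p, q, r} = {(i, j), (i - 1, j + 1), (i, j + 1)}"
    have mem: "s \<in> {p, q, r} \<longleftrightarrow> s \<in> {(i, j), (i - 1, j + 1), (i, j + 1)}" for s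
      by (simp only: eq)
    have q: "q = (i, j) \<or> q = (i - 1, j + 1) \<or> q = (i, j + 1)"
      and r: "r = (i, j) \<or> r = (i - 1, j + 1) \<or> r = (i, j + 1)"
      using mem [of q] mem [of r] by simp_all
    show ?thesis
      using q r assms mem [of "(i, j)"] mem [of "(i - 1, j + 1)"] mem [of "(i, j + 1)"]
      by (elim disjE) (auto simp: tri_def step_def)
  next
    assume eq: "{p, q, r} = {(i, j), (i - 1, j + 1), (i - 1, j)}"
    have mem: "s \<in> {p, q, r} \<longleftrightarrow> s \<in> {(i, j), (i - 1, j + 1), (i - 1, j)}" for s
      by (simp only: eq)
    have q: "q = (i, j) \<or> q = (i - 1, j + 1) \<or> q = (i - 1, j)"
      and r: "r = (i, j) \<or> r = (i - 1, j + 1) \<or> r = (i - 1, j)"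
      using mem [of q] mem [of r] by simp_all
    show ?thesis
      using q r assms mem [of "(i, j)"] mem [of "(i - 1, j + 1)"] mem [of "(i - 1, j)"]
      by (elim disjE) (auto simp: tri_def step_def)
  qed
next
  assume tri: "tri p q r"
  obtain i j where q: "q = (i, j)" by force
  have up: "alcove {(i, j), (i - 1, j + 1), (i, j + 1)}"
    and down: "alcove {(i, j), (i - 1, j + 1), (i - 1, j)}" for i j
    unfolding alcove_def by blast+
  have "(p, r) \<in> {((i - 1, j), (i - 1, j + 1)), ((i - 1, j), (i, j - 1)),
      ((i + 1, j - 1), (i + 1, j)), ((i + 1, j - 1), (i, j - 1)),
      ((i, j + 1), (i + 1, j)), ((i, j + 1), (i - 1, j + 1))}"
    using tri_cases tri unfolding q .
  then show "alcove {p, q, r}"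
    \<comment> \<open>The six alcoves around \<open>(i, j)\<close>, in the order of the pairs from
      \<open>tri_cases\<close>.\<close>
    using down [of i j] up [of i "j - 1"] up [of "i + 1" "j - 1"] down [of "i + 1" "j - 1"]
      down [of "i + 1" j] up [of i j]
    unfolding q by (auto simp: insert_commute)
qed

lemma tri_third_vertex:
  assumes "tri p q r"
  shows "tri s q r \<longleftrightarrow> s = p \<or> s = opp p q r"
proof
  assume s: "tri s q r"
  obtain i j where q: "q = (i, j)" by force
  show "s = p \<or> s = opp p q r"
    using tri_cases [OF assms [unfolded q]] tri_cases [OF s [unfolded q]]
    unfolding q by (auto simp: opp_def)
qed (use assms tri_opp in blast)

lemma opp_notin_tri:
  assumes "tri p q r"
  shows "opp p q r \<notin> {p, q, r}"
proof -
  obtain i j where q: "q = (i, j)" by force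
  show ?thesis
    using tri_cases [OF assms [unfolded q]] unfolding q by (auto simp: opp_def)
qed

text \<open>An edge borders exactly two alcoves, with third vertices \<open>p\<close> and
  \<open>opp p q r\<close>. Excluding the vertices already present leaves only the latter, so the
  definite description in \<open>flip\<close> denotes it.\<close>

lemma flip_tri:
  assumes "tri p q r" "has_color c p"
  shows "flip c {p, q, r} = {opp p q r, q, r}"
proof -
  have e: "{s \<in> {p, q, r}. \<not> has_color c s} = {q, r}"
    using assms(2) tri_colors [OF assms] by auto
  have "(THE s. s \<notin> {p, q, r} \<and> alcove (insert s {q, r})) = opp p q r"
  proof (rule the_equality)
    show "opp p q r \<notin> {p, q, r} \<and> alcove (insert (opp p q r) {q, r})"
      using assms(1) opp_notin_tri tri_opp alcove_edge_iff tri_def by metis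
    show "s = opp p q r" if "s \<notin> {p, q, r} \<and> alcove (insert s {q, r})" for s
      using that assms(1) alcove_edge_iff tri_third_vertex unfolding tri_def [of p] by (metis assms(1) insertI1)
  qed
  then show ?thesis
    unfolding flip_def e Let_def by simp
qed

lemma color_vertex_tri:
  assumes "tri p q r" "has_color c p"
  shows "color_vertex c {p, q, r} = p"
  unfolding color_vertex_def
  by (rule the_equality) (use assms(2) tri_colors [OF assms] in auto)

section \<open>The factors of the formula\<close>

lemma monomial6_nonzero [simp]: "monomial6 e \<noteq> 0"
  by (simp add: monomial6_def)

lemma x_nonzero [simp]: "x r \<noteq> 0"
  by (simp add: x_def eq_fract Zero_fract_def)

text \<open>All coefficients are positive, so the coefficient at \<open>e\<close> cannot cancel,
  even if some of the exponents coincide.\<close>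

lemma monomial6_sum_nonzero:
  "monomial6 e + monomial6 e' \<noteq> 0" "monomial6 e + monomial6 e' + monomial6 e'' \<noteq> 0"
proof -
  have "Poly_Mapping.lookup (monomial6 e + monomial6 e') e > 0"
    "Poly_Mapping.lookup (monomial6 e + monomial6 e' + monomial6 e'') e > 0"
    by (simp_all add: monomial6_def lookup_add lookup_single when_def)
  then show "monomial6 e + monomial6 e' \<noteq> 0" "monomial6 e + monomial6 e' + monomial6 e'' \<noteq> 0"
    by fastforce+
qed

lemma x_products:
  "x a * x b = Fract (monomial6 (Poly_Mapping.single a 1 + Poly_Mapping.single b 1)) 1"
  "x a * x b * x c =
     Fract (monomial6 (Poly_Mapping.single a 1 + Poly_Mapping.single b 1 + Poly_Mapping.single c 1)) 1"
  by (simp_all add: x_def monomial6_def mult_single)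

lemma x_polynomial_nonzero:
  "x a * x b + x c * x d \<noteq> 0"
  "x a * x b * x c + x a' * x b' * x c' + x a'' * x b'' * x c'' \<noteq> 0"
proof -
  show "x a * x b + x c * x d \<noteq> 0"
    unfolding x_products(1) Zero_fract_def by (simp add: eq_fract monomial6_sum_nonzero)
  show "x a * x b * x c + x a' * x b' * x c' + x a'' * x b'' * x c'' \<noteq> 0"
    unfolding x_products(2) Zero_fract_def by (simp add: eq_fract monomial6_sum_nonzero)
qed

lemma ABCDE_nonzero [simp]: "A \<noteq> 0" "B \<noteq> 0" "C \<noteq> 0" "D \<noteq> 0" "E \<noteq> 0"
  by (simp_all add: A_def B_def C_def D_def E_def x_polynomial_nonzero)

section \<open>The norm form of the hexagonal lattice plus 1, and the exponents of A, B, C\<close>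

definition nform :: "int \<times> int \<Rightarrow> int" where
  "nform p = (fst p)\<^sup>2 + fst p * snd p + (snd p)\<^sup>2 + 1"

definition A_exp :: "int \<times> int \<Rightarrow> int" where
  "A_exp p = (nform p + fst p + 2 * snd p) div 3"

definition B_exp :: "int \<times> int \<Rightarrow> int" where
  "B_exp p = (nform p + 2 * fst p + snd p) div 3"

definition C_exp :: "int \<times> int \<Rightarrow> int" where
  "C_exp p = nform p div 3"

text \<open>The color determines the remainders of the three divisions by 3, so the floors become
  exact linear equations. Each of the three remainders is smaller by 1 at its own color (1 for A, 2
  for B, 3 for C) than at the other two; this is the source of the single extra factor in a
  flip.\<close>

lemma exps_by_color:
  "has_color 1 p \<Longrightarrow> 3 * A_exp p = nform p + fst p + 2 * snd p
    \<and> 3 * B_exp p = nform p + 2 * fst p + snd p - 1 \<and> 3 * C_exp p = nform p - 2"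
  "has_color 2 p \<Longrightarrow> 3 * A_exp p = nform p + fst p + 2 * snd p - 1
    \<and> 3 * B_exp p = nform p + 2 * fst p + snd p \<and> 3 * C_exp p = nform p - 2"
  "has_color 3 p \<Longrightarrow> 3 * A_exp p = nform p + fst p + 2 * snd p - 1
    \<and> 3 * B_exp p = nform p + 2 * fst p + snd p - 1 \<and> 3 * C_exp p = nform p - 1"
proof -
  have *: "\<exists>t u. fst p = snd p + c + 3 * t \<and> nform p = 3 * u + c\<^sup>2 + 1" if "has_color c p" for c
  proof -
    have "3 dvd fst p - snd p - c"
      using that by (simp add: has_color_def cong_iff_dvd_diff)
    then obtain t where "fst p - snd p - c = 3 * t" by blast
    then have t: "fst p = snd p + c + 3 * t" by simp
    \<comment> \<open>Modulo 3 the form \<open>i\<^sup>2 + i * j + j\<^sup>2\<close> is the square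
      of \<open>i - j\<close>, so only the color survives.\<close>
    have "nform p = 3 * (3 * t\<^sup>2 + 2 * t * c + 3 * t * snd p + c * snd p + (snd p)\<^sup>2) + c\<^sup>2 + 1"
      unfolding nform_def t by (simp add: power2_eq_square algebra_simps)
    with t show ?thesis by blast
  qed
  show "3 * A_exp p = nform p + fst p + 2 * snd p
    \<and> 3 * B_exp p = nform p + 2 * fst p + snd p - 1 \<and> 3 * C_exp p = nform p - 2" if col: "has_color 1 p"
  proof -
    obtain t u where "fst p = snd p + 1 + 3 * t" "nform p = 3 * u + 2"
      using * [OF col] by auto
    then show ?thesis
      unfolding A_exp_def B_exp_def C_exp_def by presburger
  qed
  show "3 * A_exp p = nform p + fst p + 2 * snd p - 1
    \<and> 3 * B_exp p = nform p + 2 * fst p + snd p \<and> 3 * C_exp p = nform p - 2" if col: "has_color 2 p"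
  proof -
    obtain t u where "fst p = snd p + 2 + 3 * t" "nform p = 3 * u + 5"
      using * [OF col] by auto
    then show ?thesis
      unfolding A_exp_def B_exp_def C_exp_def by presburger
  qed
  show "3 * A_exp p = nform p + fst p + 2 * snd p - 1
    \<and> 3 * B_exp p = nform p + 2 * fst p + snd p - 1 \<and> 3 * C_exp p = nform p - 1" if col: "has_color 3 p"
  proof -
    obtain t u where "fst p = snd p + 3 + 3 * t" "nform p = 3 * u + 10"
      using * [OF col] by auto
    then show ?thesis
      unfolding A_exp_def B_exp_def C_exp_def by presburger
  qed
qed

text \<open>By the parallelogram law the excess is half the difference of the squared diagonals,
  which are 3 between \<open>p\<close> and its opposite and 1 between \<open>q\<close> and
  \<open>r\<close>.\<close>

lemma nform_opp:
  assumes "tri p q r"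
  shows "nform (opp p q r) + nform p = nform q + nform r + 1"
proof -
  obtain i j where q: "q = (i, j)" by force
  show ?thesis
    using tri_cases [OF assms [unfolded q]]
    unfolding q by (auto simp: opp_def nform_def power2_eq_square algebra_simps)
qed

lemma has_color_opp: "tri p q r \<Longrightarrow> has_color c (opp p q r) \<longleftrightarrow> has_color c p"
  using has_color_step [of p q c] has_color_step [of "opp p q r" q c] tri_opp [of p q r]
  by (simp add: tri_def)

definition face_factor :: "int \<times> int \<Rightarrow> ratfun6" where
  "face_factor p = A powi A_exp p * B powi B_exp p * C powi C_exp p"

lemma face_factor_nonzero [simp]: "face_factor p \<noteq> 0"
  by (simp add: face_factor_def power_int_not_zero)

lemma face_factor_mult:
  "face_factor p * face_factor q =
     A powi (A_exp p + A_exp q) * B powi (B_exp p + B_exp q) * C powi (C_exp p + C_exp q)"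
  by (simp add: face_factor_def power_int_add ac_simps)

text \<open>The linear parts of the exponents cancel because \<open>p\<close> and its opposite have
  the same sum as the edge. What is left is the excess from \<open>nform_opp\<close> and the
  remainders from \<open>exps_by_color\<close>.\<close>

lemma face_factor_opp:
  assumes tri: "tri p1 p2 p3" and col: "has_color 1 p1"
  shows "face_factor (opp p1 p2 p3) * face_factor p1 = A * (face_factor p2 * face_factor p3)"
    and "face_factor (opp p2 p3 p1) * face_factor p2 = B * (face_factor p3 * face_factor p1)"
    and "face_factor (opp p3 p1 p2) * face_factor p3 = C * (face_factor p1 * face_factor p2)"
proof -
  have cols: "has_color 2 p2" "has_color 3 p3"
    using tri_colors [OF tri col] by simp_all
  have tri2: "tri p2 p3 p1" and tri3: "tri p3 p1 p2"
    using tri tri_rotate by blast+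
  have opp1: "has_color 1 (opp p1 p2 p3)" and opp2: "has_color 2 (opp p2 p3 p1)"
    and opp3: "has_color 3 (opp p3 p1 p2)"
    by (simp_all add: has_color_opp tri tri2 tri3 col cols)
  note by_color = exps_by_color(1) [OF col] exps_by_color(2) [OF cols(1)] exps_by_color(3) [OF cols(2)]
    exps_by_color(1) [OF opp1] exps_by_color(2) [OF opp2] exps_by_color(3) [OF opp3]
  note A = by_color [THEN conjunct1] and B = by_color [THEN conjunct2, THEN conjunct1]
    and C = by_color [THEN conjunct2, THEN conjunct2]
  have fs: "fst (opp p q r) = fst q + fst r - fst p" "snd (opp p q r) = snd q + snd r - snd p" for p q r
    by (simp_all add: opp_def)
  have e1: "A_exp (opp p1 p2 p3) + A_exp p1 = 1 + (A_exp p2 + A_exp p3)"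
    "B_exp (opp p1 p2 p3) + B_exp p1 = B_exp p2 + B_exp p3"
    "C_exp (opp p1 p2 p3) + C_exp p1 = C_exp p2 + C_exp p3"
    using A(1-3) A(4) B(1-3) B(4) C(1-3) C(4) nform_opp [OF tri] unfolding fs by (smt (verit))+
  have e2: "A_exp (opp p2 p3 p1) + A_exp p2 = A_exp p3 + A_exp p1"
    "B_exp (opp p2 p3 p1) + B_exp p2 = 1 + (B_exp p3 + B_exp p1)"
    "C_exp (opp p2 p3 p1) + C_exp p2 = C_exp p3 + C_exp p1"
    using A(1-3) A(5) B(1-3) B(5) C(1-3) C(5) nform_opp [OF tri2] unfolding fs by (smt (verit))+
  have e3: "A_exp (opp p3 p1 p2) + A_exp p3 = A_exp p1 + A_exp p2"
    "B_exp (opp p3 p1 p2) + B_exp p3 = B_exp p1 + B_exp p2"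
    "C_exp (opp p3 p1 p2) + C_exp p3 = 1 + (C_exp p1 + C_exp p2)"
    using A(1-3) A(6) B(1-3) B(6) C(1-3) C(6) nform_opp [OF tri3] unfolding fs by (smt (verit))+
  have pow: "a powi (1 + n) = a * a powi n" if "a \<noteq> 0" for a :: ratfun6 and n
    using that by (simp add: power_int_add)
  show "face_factor (opp p1 p2 p3) * face_factor p1 = A * (face_factor p2 * face_factor p3)"
    "face_factor (opp p2 p3 p1) * face_factor p2 = B * (face_factor p3 * face_factor p1)"
    "face_factor (opp p3 p1 p2) * face_factor p3 = C * (face_factor p1 * face_factor p2)"
    by (simp_all add: face_factor_mult e1 e2 e3 pow mult.assoc mult.left_commute)
qed

section \<open>Rounded quarter squares and the exponents of D and E\<close>

definition quarter_square :: "int \<Rightarrow> int" where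
  "quarter_square k = k\<^sup>2 div 4"

lemma quarter_square_double: "quarter_square (2 * m) = m\<^sup>2"
  and quarter_square_double_Suc: "quarter_square (2 * m + 1) = m\<^sup>2 + m"
proof -
  show "quarter_square (2 * m) = m\<^sup>2"
    by (simp add: quarter_square_def power2_eq_square)
  have "(2 * m + 1)\<^sup>2 = 4 * (m\<^sup>2 + m) + 1"
    by (simp add: power2_eq_square algebra_simps)
  then show "quarter_square (2 * m + 1) = m\<^sup>2 + m"
    by (simp add: quarter_square_def)
qed

text \<open>Without rounding, the second difference of a quarter square is 1/2. Rounding loses 1/4
  exactly at odd arguments: at the centre this raises the value to 1, at both neighbours it lowers
  it to 0.\<close>

lemma quarter_square_neighbours:
  "quarter_square (k + 1) + quarter_square (k - 1) = (if odd k then 1 else 0) + 2 * quarter_square k"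
proof (cases "even k")
  case True
  then obtain m where k: "k = 2 * m" by blast
  have "quarter_square (k + 1) = m\<^sup>2 + m" "quarter_square k = m\<^sup>2"
    "quarter_square (k - 1) = (m - 1)\<^sup>2 + (m - 1)"
    using quarter_square_double_Suc [of m] quarter_square_double [of m]
      quarter_square_double_Suc [of "m - 1"] by (simp_all add: k)
  with True show ?thesis
    by (simp add: power2_eq_square algebra_simps)
next
  case False
  then obtain m where k: "k = 2 * m + 1" by (blast elim: oddE)
  have "quarter_square (k + 1) = (m + 1)\<^sup>2" "quarter_square k = m\<^sup>2 + m"
    "quarter_square (k - 1) = m\<^sup>2"
    using quarter_square_double [of "m + 1"] quarter_square_double_Suc [of m]
      quarter_square_double [of m] by (simp_all add: k algebra_simps)
  with False show ?thesis
    by (simp add: power2_eq_square algebra_simps)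
qed

definition height_factor :: "int \<Rightarrow> ratfun6" where
  "height_factor k = D powi quarter_square (k - 1) * E powi quarter_square k"

lemma height_factor_nonzero [simp]: "height_factor k \<noteq> 0"
  by (simp add: height_factor_def power_int_not_zero)

text \<open>The exponent of \<open>D\<close> is that of \<open>E\<close> shifted by one, so
  \<open>D\<close> gains its extra factor at even \<open>k\<close> and \<open>E\<close> at odd
  \<open>k\<close>.\<close>

lemma height_factor_neighbours:
  "height_factor (k + 1) * height_factor (k - 1) = (if odd k then E else D) * (height_factor k)\<^sup>2"
proof -
  have sq: "a powi (e + 2 * n) = a powi e * (a powi n)\<^sup>2" if "a \<noteq> 0" for a :: ratfun6 and e n
    by (simp only: mult_2 power_int_add [OF disjI1 [OF that]] power2_eq_square)
  define d e where "d = D powi quarter_square (k - 1)" and "e = E powi quarter_square k"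
  have "height_factor (k + 1) * height_factor (k - 1)
      = D powi (quarter_square (k - 1 + 1) + quarter_square (k - 1 - 1))
        * E powi (quarter_square (k + 1) + quarter_square (k - 1))"
    by (simp add: height_factor_def power_int_add ac_simps)
  also have "\<dots> = D powi (if odd (k - 1) then 1 else 0) * d\<^sup>2 * (E powi (if odd k then 1 else 0) * e\<^sup>2)"
    unfolding quarter_square_neighbours d_def e_def by (simp only: sq ABCDE_nonzero not_False_eq_True)
  also have "\<dots> = (if odd k then E else D) * (d * e)\<^sup>2"
    by (cases "even k") (simp_all add: power_mult_distrib)
  finally show ?thesis
    by (simp add: d_def e_def height_factor_def)
qed

lemma height_factor_reflect:
  assumes "\<bar>k - l\<bar> = 1"
  shows "height_factor (2 * k - l) * height_factor l = (if odd k then E else D) * (height_factor k)\<^sup>2"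
proof -
  consider "l = k - 1" "2 * k - l = k + 1" | "l = k + 1" "2 * k - l = k - 1"
    using assms by linarith
  then show ?thesis
    using height_factor_neighbours [of k] by cases (simp_all only: mult.commute)
qed

text \<open>Modulo 6, the term \<open>2 * (i - j)\<close> sees only the color and
  \<open>3 * k\<close> only the parity.\<close>

lemma var_index_by_color:
  "has_color 1 p \<Longrightarrow> var_index (fst p) (snd p) k = (if odd k then 1 else 2)"
  "has_color 2 p \<Longrightarrow> var_index (fst p) (snd p) k = (if odd k then 4 else 3)"
  "has_color 3 p \<Longrightarrow> var_index (fst p) (snd p) k = (if odd k then 5 else 6)"
proof -
  have m: "(2 * (fst p - snd p) + 3 * k) mod 6 = (2 * c + (if odd k then 3 else 0)) mod 6"
    if "has_color c p" for c
  proof -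
    have "3 dvd fst p - snd p - c"
      using that by (simp add: has_color_def cong_iff_dvd_diff)
    then obtain t where t: "fst p - snd p = c + 3 * t"
      by (metis add.commute diff_add_cancel dvdE)
    have "2 * (fst p - snd p) + 3 * k = 2 * c + (if odd k then 3 else 0) + 6 * (t + k div 2)"
      unfolding t by (cases "even k") (auto elim!: evenE oddE)
    then show ?thesis by (simp only: mod_mult_self2)
  qed
  show "has_color 1 p \<Longrightarrow> var_index (fst p) (snd p) k = (if odd k then 1 else 2)"
    "has_color 2 p \<Longrightarrow> var_index (fst p) (snd p) k = (if odd k then 4 else 3)"
    "has_color 3 p \<Longrightarrow> var_index (fst p) (snd p) k = (if odd k then 5 else 6)"
    using m [of 1] m [of 2] m [of 3] unfolding var_index_def Let_def by (cases "even k"; simp)+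
qed

lemma var_index_cong:
  assumes "[i' - j' = i - j] (mod 3)" "[k' = k] (mod 2)"
  shows "var_index i' j' k' = var_index i j k"
proof -
  have col: "has_color c (i', j') \<longleftrightarrow> has_color c (i, j)" for c
    using assms(1) unfolding has_color_def cong_def by simp
  have par: "odd k' \<longleftrightarrow> odd k"
    using assms(2) by (simp add: cong_def odd_iff_mod_2_eq_one)
  have "(i - j) mod 3 = 0 \<or> (i - j) mod 3 = 1 \<or> (i - j) mod 3 = 2"
    by presburger
  then consider "has_color 1 (i, j)" | "has_color 2 (i, j)" | "has_color 3 (i, j)"
    unfolding has_color_def cong_def by force
  then show ?thesis
    using var_index_by_color [of "(i, j)" k] var_index_by_color [of "(i', j')" k']
    unfolding col par by cases simp_all
qed

section \<open>Seeds on prisms\<close>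

definition cvar :: "int \<times> int \<Rightarrow> int \<Rightarrow> ratfun6" where
  "cvar p k = x (var_index (fst p) (snd p) k) * face_factor p * height_factor k"

definition prism_cluster ::
    "int \<times> int \<Rightarrow> int \<times> int \<Rightarrow> int \<times> int \<Rightarrow> int \<Rightarrow> int \<Rightarrow> 6 \<Rightarrow> ratfun6" where
  "prism_cluster p1 p2 p3 k1 k2 =
     vec6 (cvar p1 k1) (cvar p1 k2) (cvar p2 k2) (cvar p2 k1) (cvar p3 k1) (cvar p3 k2)"

text \<open>The invariant kept by all five operations. The colors of \<open>p2\<close> and
  \<open>p3\<close> follow from that of \<open>p1\<close>, and \<open>k1\<close> is always the odd
  height, as in \<open>prism\<close>.\<close>

definition colored_prism ::
    "int \<times> int \<Rightarrow> int \<times> int \<Rightarrow> int \<times> int \<Rightarrow> int \<Rightarrow> int \<Rightarrow> bool" where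
  "colored_prism p1 p2 p3 k1 k2 \<longleftrightarrow>
     tri p1 p2 p3 \<and> has_color 1 p1 \<and> odd k1 \<and> even k2 \<and> \<bar>k1 - k2\<bar> = 1"

lemma colored_prism_colors:
  assumes "colored_prism p1 p2 p3 k1 k2"
  shows "has_color 1 p1" "has_color 2 p2" "has_color 3 p3"
  using assms tri_colors [of p1 p2 p3 1] by (simp_all add: colored_prism_def)

lemma prism_cluster_eq:
  assumes "colored_prism p1 p2 p3 k1 k2"
  shows "prism_cluster p1 p2 p3 k1 k2 =
    vec6 (x 1 * face_factor p1 * height_factor k1) (x 2 * face_factor p1 * height_factor k2)
      (x 3 * face_factor p2 * height_factor k2) (x 4 * face_factor p2 * height_factor k1)
      (x 5 * face_factor p3 * height_factor k1) (x 6 * face_factor p3 * height_factor k2)"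
proof -
  have "odd k1" "even k2" using assms by (simp_all add: colored_prism_def)
  then show ?thesis
    by (simp add: prism_cluster_def cvar_def var_index_by_color colored_prism_colors [OF assms])
qed

lemma colored_prism_opp:
  assumes "colored_prism p1 p2 p3 k1 k2"
  shows "colored_prism (opp p1 p2 p3) p2 p3 k1 k2" "colored_prism p1 (opp p2 p3 p1) p3 k1 k2"
    "colored_prism p1 p2 (opp p3 p1 p2) k1 k2"
    "colored_prism p1 p2 p3 (2 * k2 - k1) k2" "colored_prism p1 p2 p3 k1 (2 * k1 - k2)"
  using assms abs_minus_commute [of k1 k2] tri_opp [of p1 p2 p3] tri_opp [of p2 p3 p1] tri_opp [of p3 p1 p2] has_color_opp [of p1 p2 p3]
  by (simp_all add: colored_prism_def tri_def)

lemma flip_exchange: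
  fixes a :: "'a::field"
  assumes "x1 * x2 * a = x3 * x5 + x4 * x6" "m' * m1 = a * (m2 * m3)"
  shows "(x3 * m2 * g2) * (x5 * m3 * g1) + (x4 * m2 * g1) * (x6 * m3 * g2) = (x1 * m' * g1) * (x2 * m1 * g2)"
proof -
  have "(x3 * m2 * g2) * (x5 * m3 * g1) + (x4 * m2 * g1) * (x6 * m3 * g2)
      = (x3 * x5 + x4 * x6) * (m2 * m3) * (g1 * g2)"
    by (simp add: algebra_simps)
  also have "\<dots> = x1 * x2 * (m' * m1) * (g1 * g2)"
    unfolding assms(2) assms(1) [symmetric] by (simp add: ac_simps)
  finally show ?thesis by (simp add: ac_simps)
qed

lemma ABCDE_times_denominator:
  "x 1 * x 2 * A = x 3 * x 5 + x 4 * x 6"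
  "x 3 * x 4 * B = x 1 * x 6 + x 2 * x 5"
  "x 5 * x 6 * C = x 1 * x 3 + x 2 * x 4"
  "x 1 * x 4 * x 5 * D = x 1 * x 3 * x 6 + x 2 * x 3 * x 5 + x 2 * x 4 * x 6"
  "x 2 * x 3 * x 6 * E = x 2 * x 4 * x 5 + x 1 * x 4 * x 6 + x 1 * x 3 * x 5"
  by (simp_all add: A_def B_def C_def D_def E_def add.commute add.left_commute)

text \<open>Each binomial is factored in two ways because a flip replaces the entries at both
  heights: dividing by the old entry at one height leaves the new entry at the other.\<close>

lemma prism_cluster_exchange:
  assumes "colored_prism p1 p2 p3 k1 k2"
  defines "y \<equiv> prism_cluster p1 p2 p3 k1 k2"
  shows "y 3 * y 5 + y 4 * y 6 = cvar (opp p1 p2 p3) k1 * cvar p1 k2"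
    and "y 3 * y 5 + y 4 * y 6 = cvar (opp p1 p2 p3) k2 * cvar p1 k1"
    and "y 1 * y 6 + y 2 * y 5 = cvar (opp p2 p3 p1) k2 * cvar p2 k1"
    and "y 1 * y 6 + y 2 * y 5 = cvar (opp p2 p3 p1) k1 * cvar p2 k2"
    and "y 1 * y 3 + y 2 * y 4 = cvar (opp p3 p1 p2) k1 * cvar p3 k2"
    and "y 1 * y 3 + y 2 * y 4 = cvar (opp p3 p1 p2) k2 * cvar p3 k1"
proof -
  note prisms = assms(1) colored_prism_opp(1-3) [OF assms(1)]
  note col = prisms [THEN colored_prism_colors(1)] prisms [THEN colored_prism_colors(2)]
    prisms [THEN colored_prism_colors(3)]
  have par: "odd k1" "even k2" "tri p1 p2 p3" "has_color 1 p1"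
    using assms(1) by (simp_all add: colored_prism_def)
  note ff = face_factor_opp [OF par(3,4)]
  note ex = flip_exchange [OF ABCDE_times_denominator(1) ff(1), of "height_factor k2" "height_factor k1"]
    flip_exchange [OF ABCDE_times_denominator(2) ff(2), of "height_factor k2" "height_factor k1"]
    flip_exchange [OF ABCDE_times_denominator(3) ff(3), of "height_factor k2" "height_factor k1"]
  show "y 3 * y 5 + y 4 * y 6 = cvar (opp p1 p2 p3) k1 * cvar p1 k2"
    "y 3 * y 5 + y 4 * y 6 = cvar (opp p1 p2 p3) k2 * cvar p1 k1"
    "y 1 * y 6 + y 2 * y 5 = cvar (opp p2 p3 p1) k2 * cvar p2 k1"
    "y 1 * y 6 + y 2 * y 5 = cvar (opp p2 p3 p1) k1 * cvar p2 k2"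
    "y 1 * y 3 + y 2 * y 4 = cvar (opp p3 p1 p2) k1 * cvar p3 k2"
    "y 1 * y 3 + y 2 * y 4 = cvar (opp p3 p1 p2) k2 * cvar p3 k1"
    using ex unfolding y_def prism_cluster_eq [OF assms(1)] cvar_def
    by (simp_all add: var_index_by_color col par(1,2) ac_simps)
qed

lemma cvar_nonzero [simp]: "cvar p k \<noteq> 0"
  by (simp add: cvar_def)

lemma tau_flips:
  assumes "colored_prism p1 p2 p3 k1 k2"
  shows "\<tau> Tau1 (dP3_quiver, prism_cluster p1 p2 p3 k1 k2) =
      (dP3_quiver, prism_cluster (opp p1 p2 p3) p2 p3 k1 k2)"
    and "\<tau> Tau2 (dP3_quiver, prism_cluster p1 p2 p3 k1 k2) =
      (dP3_quiver, prism_cluster p1 (opp p2 p3 p1) p3 k1 k2)"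
    and "\<tau> Tau3 (dP3_quiver, prism_cluster p1 p2 p3 k1 k2) =
      (dP3_quiver, prism_cluster p1 p2 (opp p3 p1 p2) k1 k2)"
proof -
  define y where "y = prism_cluster p1 p2 p3 k1 k2"
  have y: "y 1 = cvar p1 k1" "y 2 = cvar p1 k2" "y 3 = cvar p2 k2" "y 4 = cvar p2 k1"
    "y 5 = cvar p3 k1" "y 6 = cvar p3 k2"
    by (simp_all add: y_def prism_cluster_def)
  note ex = prism_cluster_exchange [OF assms, folded y_def]
  have "(y 3 * y 5 + y 4 * y 6) / y 2 = cvar (opp p1 p2 p3) k1"
    "(y 3 * y 5 + y 4 * y 6) / y 1 = cvar (opp p1 p2 p3) k2"
    \<comment> \<open>Unfolding \<open>ex(1)\<close> rewrites the shared binomial in both goals; in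
      the second it is folded back and factored by \<open>ex(2)\<close> instead.\<close>
    unfolding ex(1) y(2) by (simp, unfold ex(1) [symmetric] ex(2) y(1), simp)
  then show "\<tau> Tau1 (dP3_quiver, prism_cluster p1 p2 p3 k1 k2) =
      (dP3_quiver, prism_cluster (opp p1 p2 p3) p2 p3 k1 k2)"
    unfolding y_def [symmetric] tau1_seed
    by (simp add: prism_cluster_def fun_eq_vec6 y)
  have "(y 1 * y 6 + y 2 * y 5) / y 4 = cvar (opp p2 p3 p1) k2"
    "(y 1 * y 6 + y 2 * y 5) / y 3 = cvar (opp p2 p3 p1) k1"
    unfolding ex(3) y(4) by (simp, unfold ex(3) [symmetric] ex(4) y(3), simp)
  then show "\<tau> Tau2 (dP3_quiver, prism_cluster p1 p2 p3 k1 k2) =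
      (dP3_quiver, prism_cluster p1 (opp p2 p3 p1) p3 k1 k2)"
    unfolding y_def [symmetric] tau2_seed
    by (simp add: prism_cluster_def fun_eq_vec6 y)
  have "(y 1 * y 3 + y 2 * y 4) / y 6 = cvar (opp p3 p1 p2) k1"
    "(y 1 * y 3 + y 2 * y 4) / y 5 = cvar (opp p3 p1 p2) k2"
    unfolding ex(5) y(6) by (simp, unfold ex(5) [symmetric] ex(6) y(5), simp)
  then show "\<tau> Tau3 (dP3_quiver, prism_cluster p1 p2 p3 k1 k2) =
      (dP3_quiver, prism_cluster p1 p2 (opp p3 p1 p2) k1 k2)"
    unfolding y_def [symmetric] tau3_seed
    by (simp add: prism_cluster_def fun_eq_vec6 y)
qed

text \<open>The indices of the variables are the vertices in the case of \<open>\<tau>\<^sub>4\<close>; for \<open>\<tau>\<^sub>5\<close>, the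
  vertices 2, 3, 6, 4, 5, 1 take the places of 1, 4, 5, 3, 6, 2.\<close>

lemma height_exchange:
  fixes d :: "'a::field"
  assumes "x1 * x4 * x5 * d = x1 * x3 * x6 + x2 * x3 * x5 + x2 * x4 * x6"
    and "g' * g1 = d * g2\<^sup>2"
    and nz: "x1 \<noteq> 0" "x4 \<noteq> 0" "x5 \<noteq> 0" "m1 \<noteq> 0" "m2 \<noteq> 0" "m3 \<noteq> 0" "g1 \<noteq> 0"
  shows "g1 * (((x1 * m1 * g1) * (x3 * m2 * g2) * (x6 * m3 * g2)
      + (x2 * m1 * g2) * (x3 * m2 * g2) * (x5 * m3 * g1)
      + (x2 * m1 * g2) * (x4 * m2 * g1) * (x6 * m3 * g2))
      / ((x1 * m1 * g1) * (x4 * m2 * g1) * (x5 * m3 * g1))) = g'"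
proof -
  have "(x1 * m1 * g1) * (x3 * m2 * g2) * (x6 * m3 * g2)
      + (x2 * m1 * g2) * (x3 * m2 * g2) * (x5 * m3 * g1)
      + (x2 * m1 * g2) * (x4 * m2 * g1) * (x6 * m3 * g2)
      = (x1 * x3 * x6 + x2 * x3 * x5 + x2 * x4 * x6) * (m1 * m2 * m3 * g1) * g2\<^sup>2"
    by (simp add: algebra_simps power2_eq_square)
  also have "\<dots> = x1 * x4 * x5 * (m1 * m2 * m3 * g1) * (d * g2\<^sup>2)"
    unfolding assms(1) [symmetric] by (simp add: ac_simps)
  also have "\<dots> = x1 * x4 * x5 * (m1 * m2 * m3 * g1) * (g' * g1)"
    by (simp only: assms(2))
  finally show ?thesis
    using nz by simp
qed

text \<open>The scaled entries are exactly those at the height being reflected. Reflection preserves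
  parity, so their initial variables and face factors stay, and only the height factor
  changes.\<close>

lemma tau_reflections:
  assumes "colored_prism p1 p2 p3 k1 k2"
  shows "\<tau> Tau4 (dP3_quiver, prism_cluster p1 p2 p3 k1 k2) =
      (dP3_quiver, prism_cluster p1 p2 p3 (2 * k2 - k1) k2)"
    and "\<tau> Tau5 (dP3_quiver, prism_cluster p1 p2 p3 k1 k2) =
      (dP3_quiver, prism_cluster p1 p2 p3 k1 (2 * k1 - k2))"
proof -
  define y where "y = prism_cluster p1 p2 p3 k1 k2"
  have nz: "y r \<noteq> 0" for r
    using forall_6 [of "\<lambda>r. y r \<noteq> 0"] by (simp add: y_def prism_cluster_def)
  note y = prism_cluster_eq [OF assms, folded y_def]
  \<comment> \<open>The exchange relations of the flips exhibit the two binomials as products of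
    nonzero elements.\<close>
  have ex: "y 3 * y 5 + y 4 * y 6 \<noteq> 0" "y 1 * y 6 + y 2 * y 5 \<noteq> 0"
    unfolding y_def prism_cluster_exchange(1,3) [OF assms] by simp_all
  then have ex': "y 4 * y 6 + y 3 * y 5 \<noteq> 0" "y 2 * y 5 + y 1 * y 6 \<noteq> 0"
    by (simp_all only: add.commute not_False_eq_True)
  have par: "odd k1" "even k2" "\<bar>k1 - k2\<bar> = 1" "\<bar>k2 - k1\<bar> = 1"
    using assms by (auto simp: colored_prism_def)
  have h4: "height_factor (2 * k2 - k1) * height_factor k1 = D * (height_factor k2)\<^sup>2"
    and h5: "height_factor (2 * k1 - k2) * height_factor k2 = E * (height_factor k1)\<^sup>2"
    using height_factor_reflect par by simp_all
  define \<delta> where "\<delta> = (y 1 * y 3 * y 6 + y 2 * y 3 * y 5 + y 2 * y 4 * y 6) / (y 1 * y 4 * y 5)"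
  have \<delta>: "height_factor k1 * \<delta> = height_factor (2 * k2 - k1)"
    unfolding \<delta>_def y vec6_simps
    by (rule height_exchange [OF ABCDE_times_denominator(4) h4]) simp_all
  show "\<tau> Tau4 (dP3_quiver, prism_cluster p1 p2 p3 k1 k2) =
      (dP3_quiver, prism_cluster p1 p2 p3 (2 * k2 - k1) k2)"
    unfolding y_def [symmetric] tau4_seed [OF nz nz nz ex, folded \<delta>_def]
      prism_cluster_eq [OF colored_prism_opp(4) [OF assms]]
    by (simp add: fun_eq_vec6 y mult.assoc \<delta> [symmetric])
  define \<epsilon> where "\<epsilon> = (y 2 * y 4 * y 5 + y 1 * y 4 * y 6 + y 1 * y 3 * y 5) / (y 2 * y 3 * y 6)"
  have \<epsilon>: "height_factor k2 * \<epsilon> = height_factor (2 * k1 - k2)"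
    unfolding \<epsilon>_def y vec6_simps
    by (rule height_exchange [OF ABCDE_times_denominator(5) h5]) simp_all
  show "\<tau> Tau5 (dP3_quiver, prism_cluster p1 p2 p3 k1 k2) =
      (dP3_quiver, prism_cluster p1 p2 p3 k1 (2 * k1 - k2))"
    unfolding y_def [symmetric] tau5_seed [OF nz nz nz ex', folded \<epsilon>_def]
      prism_cluster_eq [OF colored_prism_opp(5) [OF assms]]
    by (simp add: fun_eq_vec6 y mult.assoc \<epsilon> [symmetric])
qed

section \<open>Words and the lattice points they reach\<close>

text \<open>All five exponents vanish at the six points of the initial prism.\<close>

lemma prism_cluster_initial: "prism_cluster (0, - 1) (- 1, 0) (0, 0) 1 0 = x"
proof -
  have "cvar (0, - 1) k = x (var_index 0 (- 1) k)" "cvar (- 1, 0) k = x (var_index (- 1) 0 k)"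
    "cvar (0, 0) k = x (var_index 0 0 k)" if "k \<in> {0, 1}" for k
    using that by (auto simp: cvar_def face_factor_def height_factor_def A_exp_def B_exp_def C_exp_def
        nform_def quarter_square_def)
  then show ?thesis
    by (simp add: prism_cluster_def fun_eq_iff forall_6 var_index_def)
qed

lemma colored_prism_initial: "colored_prism (0, - 1) (- 1, 0) (0, 0) 1 0"
  by (simp add: colored_prism_def tri_def step_def has_color_def)

lemma colored_prism_flip:
  assumes "colored_prism p1 p2 p3 k1 k2"
  shows "flip 1 {p1, p2, p3} = {opp p1 p2 p3, p2, p3}"
    and "flip 2 {p1, p2, p3} = {p1, opp p2 p3 p1, p3}"
    and "flip 3 {p1, p2, p3} = {p1, p2, opp p3 p1 p2}"
proof -
  have tri: "tri p1 p2 p3" "tri p2 p3 p1" "tri p3 p1 p2"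
    using assms by (simp_all add: colored_prism_def tri_def)
  note flips = tri [THEN flip_tri] and col = colored_prism_colors [OF assms]
  have rot: "{p2, p3, p1} = {p1, p2, p3}" "{p3, p1, p2} = {p1, p2, p3}"
    by auto
  show "flip 1 {p1, p2, p3} = {opp p1 p2 p3, p2, p3}"
    by (rule flips(1) [OF col(1)])
  show "flip 2 {p1, p2, p3} = {p1, opp p2 p3 p1, p3}"
    using flips(2) [OF col(2)] unfolding rot by auto
  show "flip 3 {p1, p2, p3} = {p1, p2, opp p3 p1 p2}"
    using flips(3) [OF col(3)] unfolding rot by auto
qed

lemma word_alcove_prism:
  assumes "set S1 \<subseteq> {Tau1, Tau2, Tau3}"
  shows "\<exists>p1 p2 p3. colored_prism p1 p2 p3 1 0 \<and> word_alcove S1 = {p1, p2, p3}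
    \<and> fold \<tau> S1 initial_seed = (dP3_quiver, prism_cluster p1 p2 p3 1 0)"
  using assms
proof (induction S1 rule: rev_induct)
  case Nil
  then show ?case
    using colored_prism_initial prism_cluster_initial
    by (auto simp: word_alcove_def initial_seed_def intro!: exI)
next
  case (snoc a S)
  then obtain p1 p2 p3 where IH: "colored_prism p1 p2 p3 1 0" "word_alcove S = {p1, p2, p3}"
    "fold \<tau> S initial_seed = (dP3_quiver, prism_cluster p1 p2 p3 1 0)"
    by auto
  have alcove: "word_alcove (S @ [a]) = letter_flip a {p1, p2, p3}"
    and seed: "fold \<tau> (S @ [a]) initial_seed = \<tau> a (dP3_quiver, prism_cluster p1 p2 p3 1 0)"
    using IH by (simp_all add: word_alcove_def)
  have step: ?case
    if "colored_prism q1 q2 q3 1 0" "letter_flip a {p1, p2, p3} = {q1, q2, q3}"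
      "\<tau> a (dP3_quiver, prism_cluster p1 p2 p3 1 0) = (dP3_quiver, prism_cluster q1 q2 q3 1 0)"
    for q1 q2 q3
    unfolding alcove seed using that by blast
  note opps = colored_prism_opp(1-3) [OF IH(1)] and flips = colored_prism_flip [OF IH(1)]
    and taus = tau_flips [OF IH(1)]
  consider "a = Tau1" | "a = Tau2" | "a = Tau3"
    using snoc.prems by auto
  then show ?case
  proof cases
    case 1
    show ?thesis by (rule step [OF opps(1)]) (simp_all only: 1 letter_flip.simps flips taus)
  next
    case 2
    show ?thesis by (rule step [OF opps(2)]) (simp_all only: 2 letter_flip.simps flips taus)
  next
    case 3
    show ?thesis by (rule step [OF opps(3)]) (simp_all only: 3 letter_flip.simps flips taus)
  qed
qed

section \<open>Heights under alternating words: two reflections of the integer line\<close>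

fun reflect_height :: "letter \<Rightarrow> int \<times> int \<Rightarrow> int \<times> int" where
  "reflect_height l (k1, k2) = (if l = Tau4 then (2 * k2 - k1, k2) else (k1, 2 * k1 - k2))"

lemma fold_tau_heights:
  assumes "set S2 \<subseteq> {Tau4, Tau5}" "colored_prism p1 p2 p3 k1 k2"
  shows "case fold reflect_height S2 (k1, k2) of (h1, h2) \<Rightarrow> colored_prism p1 p2 p3 h1 h2
    \<and> fold \<tau> S2 (dP3_quiver, prism_cluster p1 p2 p3 k1 k2) = (dP3_quiver, prism_cluster p1 p2 p3 h1 h2)"
  using assms
proof (induction S2 arbitrary: k1 k2)
  case (Cons a S)
  have "a = Tau4 \<or> a = Tau5" "set S \<subseteq> {Tau4, Tau5}"
    using Cons.prems(1) by auto
  then show ?case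
    using tau_reflections [OF Cons.prems(2)] colored_prism_opp(4,5) [OF Cons.prems(2), THEN Cons.IH [rotated]]
    by (elim disjE) (simp_all del: \<tau>.simps)
qed simp

text \<open>Each letter carries the trailing height past the leading one, so the pair advances by
  \<open>d\<close> per letter. The initial heights are arbitrary because the induction continues
  from the reflected pair, with the same signed gap \<open>d\<close>.\<close>

lemma fold_reflect_height:
  assumes "distinct_adj w" "set w \<subseteq> {Tau4, Tau5}" "w \<noteq> []"
  defines "n \<equiv> int (length w)"
  shows "fold reflect_height w (k1, k2) =
    (if hd w = Tau4
     then let d = k2 - k1 in
       if odd (length w) then (k2 + n * d, k2 + (n - 1) * d) else (k2 + (n - 1) * d, k2 + n * d)
     else let d = k1 - k2 in
       if odd (length w) then (k1 + (n - 1) * d, k1 + n * d) else (k1 + n * d, k1 + (n - 1) * d))"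
  using assms(1-3) unfolding n_def
proof (induction w arbitrary: k1 k2)
  case (Cons a w)
  show ?case
  proof (cases w)
    case Nil
    then show ?thesis using Cons.prems(2) by (simp add: Let_def)
  next
    case (Cons b v)
    then have w: "w \<noteq> []" "hd w = b" "a \<noteq> b" "a = Tau4 \<or> a = Tau5" "b = Tau4 \<or> b = Tau5"
      using Cons.prems by auto
    have IH: "fold reflect_height w (k1, k2) =
      (if hd w = Tau4
       then let d = k2 - k1; n = int (length w) in
         if odd (length w) then (k2 + n * d, k2 + (n - 1) * d) else (k2 + (n - 1) * d, k2 + n * d)
       else let d = k1 - k2; n = int (length w) in
         if odd (length w) then (k1 + (n - 1) * d, k1 + n * d) else (k1 + n * d, k1 + (n - 1) * d))"
      for k1 k2
      using Cons.IH [of k1 k2] Cons.prems w(1) by (simp add: Let_def distinct_adj_Cons)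
    show ?thesis
      using w by (elim disjE) (simp_all add: IH Let_def algebra_simps)
  qed
qed simp

lemma heights_eq_fold:
  assumes "distinct_adj S2" "set S2 \<subseteq> {Tau4, Tau5}"
  shows "heights S2 = fold reflect_height S2 (1, 0)"
proof (cases "S2 = []")
  case False
  then show ?thesis
    using fold_reflect_height [OF assms False, of 1 0] by (simp add: heights_def Let_def)
qed (simp add: heights_def)

text \<open>Every value is \<open>cvar\<close> of its own point, whatever the words; this gives the
  well-definedness of the attachment.\<close>

lemma zip_prism_cluster:
  assumes "set S1 \<subseteq> {Tau1, Tau2, Tau3}" "set S2 \<subseteq> {Tau4, Tau5}" "distinct_adj S2"
  shows "set (zip (prism S1 S2) (cluster (S1 @ S2))) =
    (\<lambda>(p, k). ((fst p, snd p, k), cvar p k)) ` (word_alcove S1 \<times> {fst (heights S2), snd (heights S2)})"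
proof -
  obtain p1 p2 p3 where p: "colored_prism p1 p2 p3 1 0" "word_alcove S1 = {p1, p2, p3}"
    "fold \<tau> S1 initial_seed = (dP3_quiver, prism_cluster p1 p2 p3 1 0)"
    using word_alcove_prism [OF assms(1)] by blast
  obtain h1 h2 where h: "heights S2 = (h1, h2)" by fastforce
  then have seed: "fold \<tau> (S1 @ S2) initial_seed = (dP3_quiver, prism_cluster p1 p2 p3 h1 h2)"
    using fold_tau_heights [OF assms(2) p(1)] heights_eq_fold [OF assms(3,2)] p(3) by simp
  have tri: "tri p1 p2 p3" "tri p2 p3 p1" "tri p3 p1 p2"
    using p(1) by (simp_all add: colored_prism_def tri_def)
  have rot: "{p2, p3, p1} = {p1, p2, p3}" "{p3, p1, p2} = {p1, p2, p3}"
    by auto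
  have "color_vertex 1 {p1, p2, p3} = p1" "color_vertex 2 {p1, p2, p3} = p2"
    "color_vertex 3 {p1, p2, p3} = p3"
    using tri [THEN color_vertex_tri] colored_prism_colors [OF p(1)] unfolding rot by blast+
  then show ?thesis
    unfolding prism_def cluster_def seed p(2) h
    by (cases p1; cases p2; cases p3) (auto simp: prism_cluster_def)
qed

section \<open>Every lattice point is attained\<close>

definition reachable :: "(int \<times> int) set \<Rightarrow> bool" where
  "reachable T \<longleftrightarrow> (\<exists>S1. set S1 \<subseteq> {Tau1, Tau2, Tau3} \<and> word_alcove S1 = T)"

lemma reachable_opp:
  assumes "reachable {p, q, r}" "tri p q r"
  shows "reachable {opp p q r, q, r}"
proof -
  obtain S1 where S1: "set S1 \<subseteq> {Tau1, Tau2, Tau3}" "word_alcove S1 = {p, q, r}"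
    using assms(1) by (auto simp: reachable_def)
  have "(fst p - snd p) mod 3 = 0 \<or> (fst p - snd p) mod 3 = 1 \<or> (fst p - snd p) mod 3 = 2"
    by presburger
  then consider "has_color 1 p" | "has_color 2 p" | "has_color 3 p"
    unfolding has_color_def cong_def by force
  then obtain a where a: "a \<in> {Tau1, Tau2, Tau3}" "letter_flip a {p, q, r} = {opp p q r, q, r}"
  proof cases
    case 1
    then show ?thesis using that [of Tau1] flip_tri [OF assms(2)] by simp
  next
    case 2
    then show ?thesis using that [of Tau2] flip_tri [OF assms(2)] by simp
  next
    case 3
    then show ?thesis using that [of Tau3] flip_tri [OF assms(2)] by simp
  qed
  have "word_alcove (S1 @ [a]) = {opp p q r, q, r}"
    using S1(2) a(2) by (simp add: word_alcove_def)
  moreover have "set (S1 @ [a]) \<subseteq> {Tau1, Tau2, Tau3}"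
    using S1(1) a(1) by auto
  ultimately show ?thesis unfolding reachable_def by blast
qed

text \<open>Two flips, through an alcove of the other orientation, translate an alcove by a unit vector.\<close>

lemma reachable_up_neighbours:
  assumes "reachable {(i, j), (i - 1, j + 1), (i, j + 1)}" (is "reachable (?U i j)")
  shows "reachable (?U (i + 1) j)" "reachable (?U (i - 1) j)"
    "reachable (?U i (j + 1))" "reachable (?U i (j - 1))"
proof -
  have flip: "reachable {s, q, r}"
    if "reachable T" "T = {p, q, r}" "tri p q r" "s = opp p q r" for T p q r s
    using reachable_opp that by blast
  note defs = tri_def step_def opp_def
  have V: "reachable {(i + 1, j), (i, j + 1), (i, j)}"
    by (rule flip [OF assms, of "(i - 1, j + 1)"]) (auto simp: defs)
  show "reachable (?U (i + 1) j)"
    using flip [OF V, of "(i, j)" "(i + 1, j)" "(i, j + 1)" "(i + 1, j + 1)"]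
    by (auto simp: defs insert_commute)
  have W: "reachable {(i - 1, j), (i, j), (i - 1, j + 1)}"
    by (rule flip [OF assms, of "(i, j + 1)"]) (auto simp: defs)
  show "reachable (?U (i - 1) j)"
    using flip [OF W, of "(i, j)" "(i - 1, j + 1)" "(i - 1, j)" "(i - 2, j + 1)"]
    by (auto simp: defs insert_commute)
  show "reachable (?U i (j - 1))"
    using flip [OF W, of "(i - 1, j + 1)" "(i - 1, j)" "(i, j)" "(i, j - 1)"]
    by (auto simp: defs insert_commute)
  have X: "reachable {(i - 1, j + 2), (i - 1, j + 1), (i, j + 1)}"
    by (rule flip [OF assms, of "(i, j)"]) (auto simp: defs)
  show "reachable (?U i (j + 1))"
    using flip [OF X, of "(i - 1, j + 1)" "(i, j + 1)" "(i - 1, j + 2)" "(i, j + 2)"]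
    by (auto simp: defs insert_commute add.commute)
qed

lemma reachable_up: "reachable {(i, j), (i - 1, j + 1), (i, j + 1)}"
proof -
  have "reachable {(0, - 1), (- 1, 0), (0, 0)}"
    unfolding reachable_def by (rule exI [of _ "[]"]) (simp add: word_alcove_def)
  \<comment> \<open>The initial alcove has this shape with \<open>i = 0\<close> and
    \<open>j = - 1\<close>, the base points of the two inductions.\<close>
  then have "reachable {(i, - 1), (i - 1, - 1 + 1), (i, - 1 + 1)}"
    by (induction i rule: int_induct [where k = 0])
      (use reachable_up_neighbours(1,2) [of _ "- 1"] in auto)
  then show ?thesis
    by (induction j rule: int_induct [where k = "- 1"])
      (use reachable_up_neighbours(3,4) [of i] in auto)
qed

fun alternating :: "letter \<Rightarrow> letter \<Rightarrow> nat \<Rightarrow> letter list" where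
  "alternating a b 0 = []"
| "alternating a b (Suc n) = a # alternating b a n"

lemma alternating:
  assumes "a \<noteq> b"
  shows "length (alternating a b n) = n" "set (alternating a b n) \<subseteq> {a, b}"
    "distinct_adj (alternating a b n)" "n > 0 \<Longrightarrow> hd (alternating a b n) = a"
proof -
  show "length (alternating a b n) = n"
    by (induction n arbitrary: a b) auto
  show "set (alternating a b n) \<subseteq> {a, b}"
    by (induction n arbitrary: a b) auto
  show hd: "n > 0 \<Longrightarrow> hd (alternating a b n) = a" for n a b
    by (cases n) auto
  show "distinct_adj (alternating a b n)"
    using assms
  proof (induction n arbitrary: a b)
    case (Suc n)
    then show ?case using hd [of n b a] by (cases n) auto
  qed simp
qed

lemma height_attained:
  "\<exists>S2. set S2 \<subseteq> {Tau4, Tau5} \<and> distinct_adj S2 \<and> k \<in> {fst (heights S2), snd (heights S2)}"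
proof -
  \<comment> \<open>A word of length \<open>n\<close> has \<open>n\<close> or \<open>- n\<close>
    among its heights, with the sign chosen by the first letter.\<close>
  define S2 where "S2 = (if k \<ge> 0 then alternating Tau5 Tau4 (nat k) else alternating Tau4 Tau5 (nat (- k)))"
  have "set S2 \<subseteq> {Tau4, Tau5}" "distinct_adj S2"
    using alternating(2,3) [of Tau5 Tau4] alternating(2,3) [of Tau4 Tau5] by (auto simp: S2_def)
  moreover have "k \<in> {fst (heights S2), snd (heights S2)}"
  proof (cases "k > 0")
    case True
    then show ?thesis
      using alternating(1,4) [of Tau5 Tau4 "nat k"] by (simp add: S2_def heights_def Let_def)
  next
    case False
    then show ?thesis
      using alternating(1,4) [of Tau4 Tau5 "nat (- k)"]
      by (cases "k = 0") (simp_all add: S2_def heights_def Let_def flip: length_0_conv)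
  qed
  ultimately show ?thesis by blast
qed

lemma attached_iff: "attached (i, j, k) v \<longleftrightarrow> v = cvar (i, j) k"
proof
  assume "attached (i, j, k) v"
  then obtain S1 S2 where "set S1 \<subseteq> {Tau1, Tau2, Tau3}" "set S2 \<subseteq> {Tau4, Tau5}" "distinct_adj S2"
    "((i, j, k), v) \<in> set (zip (prism S1 S2) (cluster (S1 @ S2)))"
    unfolding attached_def by blast
  then show "v = cvar (i, j) k"
    by (auto simp: zip_prism_cluster)
next
  assume v: "v = cvar (i, j) k"
  obtain S1 where S1: "set S1 \<subseteq> {Tau1, Tau2, Tau3}" "(i, j) \<in> word_alcove S1"
    using reachable_up [of i j] unfolding reachable_def by blast
  obtain S2 where S2: "set S2 \<subseteq> {Tau4, Tau5}" "distinct_adj S2"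
    "k \<in> {fst (heights S2), snd (heights S2)}"
    using height_attained by blast
  have "((i, j, k), v) \<in> set (zip (prism S1 S2) (cluster (S1 @ S2)))"
    unfolding zip_prism_cluster [OF S1(1) S2(1,2)] v
    using S1(2) S2(3) by (intro image_eqI [of _ _ "((i, j), k)"]) auto
  then show "attached (i, j, k) v"
    unfolding attached_def using S1(1) S2(1,2) by blast
qed

section \<open>Laurent polynomials\<close>

lemma monomial6_mult: "monomial6 e * monomial6 e' = monomial6 (e + e')"
  by (simp add: monomial6_def mult_single)

lemma laurent_polynomial_mult:
  assumes "laurent_polynomial f" "laurent_polynomial g"
  shows "laurent_polynomial (f * g)"
proof -
  obtain p e q e' where "f = Fract p (monomial6 e)" "g = Fract q (monomial6 e')"
    using assms unfolding laurent_polynomial_def by blast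
  then have "f * g = Fract (p * q) (monomial6 (e + e'))"
    by (simp add: monomial6_mult)
  then show ?thesis unfolding laurent_polynomial_def by blast
qed

lemma laurent_polynomial_add:
  assumes "laurent_polynomial f" "laurent_polynomial g"
  shows "laurent_polynomial (f + g)"
proof -
  obtain p e q e' where "f = Fract p (monomial6 e)" "g = Fract q (monomial6 e')"
    using assms unfolding laurent_polynomial_def by blast
  then have "f + g = Fract (p * monomial6 e' + q * monomial6 e) (monomial6 (e + e'))"
    by (simp add: monomial6_mult)
  then show ?thesis unfolding laurent_polynomial_def by blast
qed

lemma laurent_polynomial_1: "laurent_polynomial 1"
proof -
  have "(1::ratfun6) = Fract 1 (monomial6 0)"
    by (simp add: monomial6_def One_fract_def)
  then show ?thesis unfolding laurent_polynomial_def by blast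
qed

lemma laurent_polynomial_x: "laurent_polynomial (x r)" "laurent_polynomial (inverse (x r))"
proof -
  have "x r = Fract (monomial6 (Poly_Mapping.single r 1)) (monomial6 0)"
    "inverse (x r) = Fract 1 (monomial6 (Poly_Mapping.single r 1))"
    by (simp_all add: x_def monomial6_def)
  then show "laurent_polynomial (x r)" "laurent_polynomial (inverse (x r))"
    unfolding laurent_polynomial_def by blast+
qed

lemma laurent_polynomial_powi:
  assumes "laurent_polynomial f" "n \<ge> 0"
  shows "laurent_polynomial (f powi n)"
proof -
  have "laurent_polynomial (f ^ m)" for m
    by (induction m) (simp_all add: laurent_polynomial_1 laurent_polynomial_mult assms(1))
  then show ?thesis using assms(2) by (simp add: power_int_def)
qed

lemma laurent_polynomial_ABCDE:
  "laurent_polynomial A" "laurent_polynomial B" "laurent_polynomial C"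
  "laurent_polynomial D" "laurent_polynomial E"
  by (simp_all add: A_def B_def C_def D_def E_def divide_inverse inverse_mult_distrib
      laurent_polynomial_mult laurent_polynomial_add laurent_polynomial_x)

text \<open>This gives Laurentness: \<open>A\<close> to \<open>E\<close> are sums of several
  monomials, so negative powers would not be covered by closure under products.\<close>

lemma exps_nonneg: "A_exp p \<ge> 0" "B_exp p \<ge> 0" "C_exp p \<ge> 0" "quarter_square k \<ge> 0"
proof -
  obtain i j where p: "p = (i, j)" by force
  have sq: "a\<^sup>2 + a * b + b\<^sup>2 \<ge> 0" for a b :: int
  proof -
    have "2 * (a\<^sup>2 + a * b + b\<^sup>2) = a\<^sup>2 + b\<^sup>2 + (a + b)\<^sup>2"
      by (simp add: power2_eq_square algebra_simps)
    then show ?thesis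
      by (smt (verit) zero_le_power2)
  qed
  \<comment> \<open>The numerators for \<open>A\<close> and \<open>B\<close> are the norm form at
    the shifted points \<open>(i, j + 1)\<close> and \<open>(i + 1, j)\<close>.\<close>
  have "nform p + fst p + 2 * snd p = i\<^sup>2 + i * (j + 1) + (j + 1)\<^sup>2"
    "nform p + 2 * fst p + snd p = (i + 1)\<^sup>2 + (i + 1) * j + j\<^sup>2"
    by (simp_all add: p nform_def power2_eq_square algebra_simps)
  then show "A_exp p \<ge> 0" "B_exp p \<ge> 0"
    using sq [of i "j + 1"] sq [of "i + 1" j]
    by (simp_all only: A_exp_def B_exp_def pos_imp_zdiv_nonneg_iff zero_less_numeral)
  show "C_exp p \<ge> 0"
    using sq [of i j] by (simp add: C_exp_def nform_def p)
  show "quarter_square k \<ge> 0"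
    by (simp add: quarter_square_def pos_imp_zdiv_nonneg_iff)
qed

lemma laurent_polynomial_cvar: "laurent_polynomial (cvar p k)"
  unfolding cvar_def face_factor_def height_factor_def
  by (intro laurent_polynomial_mult laurent_polynomial_powi laurent_polynomial_ABCDE laurent_polynomial_x
      exps_nonneg)

theorem theorem3p1:
  fixes i j k :: int
  shows "(\<exists>!v. attached (i, j, k) v)
    \<and> laurent_polynomial (z i j k)
    \<and> z i j k = x (var_index i j k)
        * A powi (((i\<^sup>2 + i * j + j\<^sup>2 + 1) + i + 2 * j) div 3)
        * B powi (((i\<^sup>2 + i * j + j\<^sup>2 + 1) + 2 * i + j) div 3)
        * C powi ((i\<^sup>2 + i * j + j\<^sup>2 + 1) div 3)
        * D powi ((k - 1)\<^sup>2 div 4)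
        * E powi (k\<^sup>2 div 4)
    \<and> (\<forall>i' j' k'. [i' - j' = i - j] (mod 3) \<and> [k' = k] (mod 2)
          \<longrightarrow> var_index i' j' k' = var_index i j k)"
proof (intro conjI allI impI)
  show "\<exists>!v. attached (i, j, k) v"
    by (simp add: attached_iff)
  have z: "z i j k = cvar (i, j) k"
    by (simp add: z_def attached_iff)
  show "laurent_polynomial (z i j k)"
    unfolding z by (rule laurent_polynomial_cvar)
  show "z i j k = x (var_index i j k)
        * A powi (((i\<^sup>2 + i * j + j\<^sup>2 + 1) + i + 2 * j) div 3)
        * B powi (((i\<^sup>2 + i * j + j\<^sup>2 + 1) + 2 * i + j) div 3)
        * C powi ((i\<^sup>2 + i * j + j\<^sup>2 + 1) div 3)
        * D powi ((k - 1)\<^sup>2 div 4)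
        * E powi (k\<^sup>2 div 4)"
    unfolding z cvar_def face_factor_def height_factor_def A_exp_def B_exp_def C_exp_def nform_def
      quarter_square_def
    by (simp add: mult.assoc)
  show "var_index i' j' k' = var_index i j k"
    if "[i' - j' = i - j] (mod 3) \<and> [k' = k] (mod 2)" for i' j' k'
    using that var_index_cong by blast
qed

end
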